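(* Let a single immersed body occupy the region $V_b(t)\subset\Omega\subset\mathbb{R}^d$ ($d\in\{2,3\}$), and let $\mathbf{u},p$ satisfy the immersed boundary momentum and continuity equations $$\rho\left(\frac{\partial\mathbf{u}}{\partial t}+\mathbf{u}\cdot\nabla\mathbf{u}\right)=-\nabla p+\mu\nabla^2\mathbf{u}+\mathbf{f},\qquad \nabla\cdot\mathbf{u}=0\quad\text{in }\Omega,$$ with constant $\rho,\mu$ and $$\mathbf{f}(\mathbf{x},t)=\int_U\mathbf{F}(\mathbf{s},t)\,\delta(\mathbf{x}-\mathbf{X}(\mathbf{s},t))\,d\mathbf{s},$$ where $\mathbf{F}$ is the Lagrange multiplier (Lagrangian force density) imposing the rigidity constraint, $\mathbf{X}(\mathbf{s},t)$ is the position of the material point $\mathbf{s}\in U$, and $\delta$ is the Dirac delta function or Peskin's regularized delta function. Let $V_{CV}(t)$ be an arbitrary (possibly time-dependent) region with $V_b(t)\subset V_{CV}(t)\subset\Omega$, boundary $S_{CV}(t)$ and unit outward normal $\mathbf{n}$. Then $$\int_{V_{CV}(t)}\mathbf{f}\,dV=\int_{V_b(t)}\mathbf{F}\,dV=\int_{V_{CV}(t)}\rho\frac{\partial\mathbf{u}}{\partial t}\,dV-\oint_{S_{CV}(t)}\mathbf{n}\cdot\left[-p\mathbf{I}-\mathbf{u}\rho\mathbf{u}+\mathbf{T}\right]dS,$$ and consequently the control volume and Lagrange multiplier expressions for the hydrodynamic force and torque on the body are equivalent: (i) (Force) $$-\int_{V_{CV}(t)}\rho\frac{\partial\mathbf{u}}{\partial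 t}\,dV+\frac{d}{dt}\int_{V_b(t)}\rho\,\mathbf{u}\,dV+\oint_{S_{CV}(t)}\mathbf{n}\cdot\left[-p\mathbf{I}-\mathbf{u}\rho\mathbf{u}+\mathbf{T}\right]dS=\frac{d}{dt}\int_{V_b(t)}\rho\,\mathbf{U}\,dV-\int_{V_b(t)}\mathbf{F}\,dV.$$ (ii) (Torque) For a reference point $\mathbf{x}_0=\mathbf{X}_0$, which may be fixed or move with time, with $\mathbf{r}=\mathbf{x}-\mathbf{x}_0$ and $\mathbf{R}=\mathbf{X}-\mathbf{X}_0$, $$-\int_{V_{CV}(t)}\rho\,\mathbf{r}\wedge\frac{\partial\mathbf{u}}{\partial t}\,dV+\frac{d}{dt}\int_{V_b(t)}\rho\,(\mathbf{r}\wedge\mathbf{u})\,dV+\oint_{S_{CV}(t)}\left[\mathbf{r}\wedge(-p\,\mathbf{n}+\mathbf{n}\cdot\mathbf{T})-(\mathbf{n}\cdot\mathbf{u})\rho(\mathbf{r}\wedge\mathbf{u})\right]dS$$ $$=\frac{d}{dt}\int_{V_b(t)}\rho\,\mathbf{R}\wedge\mathbf{U}\,dV-\int_{V_b(t)}\mathbf{R}\wedge\mathbf{F}\,dV.$$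
   Context: $\mathbf{T}=\mu(\nabla\mathbf{u}+\nabla\mathbf{u}^T)$ is the viscous stress tensor, $\mathbf{I}$ is the identity tensor, and $\mathbf{n}\cdot(\mathbf{u}\rho\mathbf{u})=\rho(\mathbf{n}\cdot\mathbf{u})\mathbf{u}$. The symbol $\wedge$ is the cross product in $\mathbb{R}^3$ (for $d=2$, its $z$-component $\mathbf{a}\wedge\mathbf{b}=a_1b_2-a_2b_1$). $U\subset\mathbb{R}^d$ is the Lagrangian coordinate domain of the body, whose material points $\mathbf{X}(\mathbf{s},t)$, $\mathbf{s}\in U$, occupy $V_b(t)$. The body has the same uniform density $\rho$ as the fluid, and the body velocity is $\mathbf{U}(\mathbf{s},t)=\int_\Omega\mathbf{u}(\mathbf{x},t)\,\delta(\mathbf{x}-\mathbf{X}(\mathbf{s},t))\,d\mathbf{x}=\partial\mathbf{X}/\partial t(\mathbf{s},t)$. The Eulerian force density $\mathbf{f}$ is non-zero only in the structure region. The (Dirac or regularized) delta function satisfies $\int_\Omega\delta(\mathbf{x}-\mathbf{X}(\mathbf{s},t))\,d\mathbf{x}=1$, so that $\int_\Omega\mathbf{f}\,d\mathbf{x}=\int_U\mathbf{F}\,d\mathbf{s}$. Integrals of the Lagrangian quantities $\mathbf{F}$, $\mathbf{R}\wedge\mathbf{F}$, $\rho\mathbf{U}$, $\rho\mathbf{R}\wedge\mathbf{U}$ "over $V_b(t)$" are integrals over the material domain $U$ with respect to $d\mathbf{s}$. The body's linear and angular momentum are identified in the two descriptions: $\int_{V_b(t)}\rho\mathbf{u}\,d\mathbf{x}=\int_U\rho\,\mathbf{U}\,d\mathbf{s}$,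 and likewise for $\rho\,\mathbf{r}\wedge\mathbf{u}$ and $\rho\,\mathbf{R}\wedge\mathbf{U}$. The right-hand sides of (i) and (ii) are the hydrodynamic force $\boldsymbol{\mathcal F}$ and torque $\boldsymbol{\mathcal M}$ given by the balance laws $\frac{d}{dt}\int_{V_b(t)}\rho\mathbf{U}\,dV=\boldsymbol{\mathcal F}+\int_{V_b(t)}\mathbf{F}\,dV$ and $\frac{d}{dt}\int_{V_b(t)}\rho\,\mathbf{R}\wedge\mathbf{U}\,dV=\boldsymbol{\mathcal M}+\int_{V_b(t)}\mathbf{R}\wedge\mathbf{F}\,dV$; the left-hand sides are the control volume expressions, under no-slip on the body surface. All fields and regions are assumed smooth enough for the divergence theorem and the differentiations above. *)

theory Defs
  imports "HOL-Analysis.Analysis"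
begin

section \<open>Surface measure, outward normals and the divergence theorem\<close>

definition hausdorff_weight :: "nat \<Rightarrow> 'a::metric_space set \<Rightarrow> ennreal" where
  "hausdorff_weight m C =
     (if C = {} then 0 else ennreal (unit_ball_vol (real m) * (diameter C / 2) ^ m))"

definition hausdorff_content :: "nat \<Rightarrow> real \<Rightarrow> 'a::metric_space set \<Rightarrow> ennreal" where
  "hausdorff_content m e A =
     (INF C\<in>{C :: nat \<Rightarrow> 'a set. A \<subseteq> (\<Union>i. C i) \<and> (\<forall>i. bounded (C i) \<and> diameter (C i) \<le> e)}.
        \<Sum>i. hausdorff_weight m (C i))"

definition hausdorff_outer :: "nat \<Rightarrow> 'a::metric_space set \<Rightarrow> ennreal" where
  "hausdorff_outer m A = (SUP e\<in>{0<..}. hausdorff_content m e A)"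

definition hausdorff_measure :: "nat \<Rightarrow> 'a::metric_space measure" where
  "hausdorff_measure m = measure_of UNIV (sets borel) (hausdorff_outer m)"

lemma hausdorff_content_le:
  assumes "A \<subseteq> (\<Union>i. C i)" "\<And>i. bounded (C i) \<and> diameter (C i) \<le> e"
  shows "hausdorff_content m e A \<le> (\<Sum>i. hausdorff_weight m (C i))"
  unfolding hausdorff_content_def using assms by (intro INF_lower) auto

lemma hausdorff_content_mono:
  assumes "A \<subseteq> B" "e' \<le> e" shows "hausdorff_content m e A \<le> hausdorff_content m e' B"
  unfolding hausdorff_content_def
proof (rule INF_superset_mono)
  show "{C. B \<subseteq> (\<Union>i. C i) \<and> (\<forall>i. bounded (C i) \<and> diameter (C i) \<le> e')}
      \<subseteq> {C. A \<subseteq> (\<Union>i. C i) \<and> (\<forall>i. bounded (C i) \<and> diameter (C i) \<le> e)}"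
    using assms by (auto intro: order_trans)
qed simp

lemma hausdorff_content_subadditive:
  "hausdorff_content m e (\<Union>n. A n) \<le> (\<Sum>n. hausdorff_content m e (A n))"
proof (rule ennreal_le_epsilon)
  let ?O = "hausdorff_content m e"
  fix b :: real assume b: "0 < b" and fin: "(\<Sum>n. ?O (A n)) < top"
  have "\<exists>B. A n \<subseteq> (\<Union>i. B i) \<and> (\<forall>i. bounded (B i) \<and> diameter (B i) \<le> e) \<and>
      (\<Sum>i. hausdorff_weight m (B i)) \<le> ?O (A n) + b * (1 / 2) ^ Suc n" for n
  proof -
    have "?O (A n) < top" using fin by (auto simp: less_top dest!: ennreal_suminf_lessD)
    then have "?O (A n) < ?O (A n) + b * (1 / 2) ^ Suc n"
      using b by (cases "?O (A n)") (auto simp: ennreal_plus[symmetric] ennreal_less_iff simp del: ennreal_plus)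
    then show ?thesis
      unfolding hausdorff_content_def[of m e "A n"] INF_less_iff by (auto intro: less_imp_le)
  qed
  then obtain B where B: "\<And>n. A n \<subseteq> (\<Union>i. B n i)"
    "\<And>n i. bounded (B n i) \<and> diameter (B n i) \<le> e"
    and Ble: "\<And>n. (\<Sum>i. hausdorff_weight m (B n i)) \<le> ?O (A n) + b * (1 / 2) ^ Suc n"
    by metis
  define C where "C = case_prod B o prod_decode"
  have "(\<Union>n. A n) \<subseteq> (\<Union>i. C i)"
    using B(1) by (auto simp: C_def subset_eq) (metis prod.case prod_encode_inverse)
  moreover have "bounded (C i) \<and> diameter (C i) \<le> e" for i
    using B(2) by (simp add: C_def split: prod.split)
  ultimately have "?O (\<Union>n. A n) \<le> (\<Sum>i. hausdorff_weight m (C i))"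
    by (rule hausdorff_content_le)
  also have "\<dots> = (\<Sum>n. \<Sum>i. hausdorff_weight m (B n i))"
    using suminf_ennreal_2dimen[of "\<lambda>n. \<Sum>i. hausdorff_weight m (B n i)"
        "\<lambda>(n, i). hausdorff_weight m (B n i)"]
    by (simp add: C_def comp_def split_def)
  also have "\<dots> \<le> (\<Sum>n. ?O (A n) + b * (1 / 2) ^ Suc n)"
    by (intro suminf_le allI Ble) auto
  also have "\<dots> = (\<Sum>n. ?O (A n)) + (\<Sum>n. ennreal b * ennreal ((1 / 2) ^ Suc n))"
    using b by (subst suminf_add[symmetric])
      (auto simp del: ennreal_suminf_cmult simp add: ennreal_mult[symmetric])
  also have "\<dots> = (\<Sum>n. ?O (A n)) + b"
    unfolding ennreal_suminf_cmult
    by (subst suminf_ennreal_eq[OF zero_le_power power_half_series]) auto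
  finally show "?O (\<Union>n. A n) \<le> (\<Sum>n. ?O (A n)) + b" .
qed

lemma hausdorff_outer_mono: "A \<subseteq> B \<Longrightarrow> hausdorff_outer m A \<le> hausdorff_outer m B"
  unfolding hausdorff_outer_def by (intro SUP_mono') (auto intro: hausdorff_content_mono)

lemma hausdorff_content_le_outer: "0 < e \<Longrightarrow> hausdorff_content m e A \<le> hausdorff_outer m A"
  unfolding hausdorff_outer_def by (auto intro: SUP_upper)

lemma hausdorff_outer_empty: "hausdorff_outer m {} = 0"
proof -
  have "hausdorff_content m e ({} :: 'a set) \<le> 0" if "0 < e" for e
    using hausdorff_content_le[of "{}" "\<lambda>_. {}" e m] that
    by (simp add: hausdorff_weight_def)
  then show ?thesis unfolding hausdorff_outer_def by (simp add: SUP_eq_iff)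
qed

lemma hausdorff_outer_subadditive: "hausdorff_outer m (\<Union>n. A n) \<le> (\<Sum>n. hausdorff_outer m (A n))"
  unfolding hausdorff_outer_def[of m "\<Union>n. A n"]
proof (rule SUP_least)
  fix e :: real assume "e \<in> {0<..}"
  then show "hausdorff_content m e (\<Union>n. A n) \<le> (\<Sum>n. hausdorff_outer m (A n))"
    by (intro order_trans[OF hausdorff_content_subadditive] suminf_le)
       (auto intro: hausdorff_content_le_outer)
qed

lemma hausdorff_outer_Un: "hausdorff_outer m (A \<union> B) \<le> hausdorff_outer m A + hausdorff_outer m B"
proof -
  have *: "(\<Union>n. if n = 0 then A else if n = Suc 0 then B else {}) = A \<union> B"
    by (auto split: if_splits)
  have "hausdorff_outer m (A \<union> B)
      \<le> (\<Sum>n. hausdorff_outer m (if n = 0 then A else if n = Suc 0 then B else {}))"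
    using hausdorff_outer_subadditive[of m "\<lambda>n. if n = 0 then A else if n = Suc 0 then B else {}"]
    unfolding * .
  also have "\<dots> = (\<Sum>n\<in>{0, Suc 0}. hausdorff_outer m (if n = 0 then A else if n = Suc 0 then B else {}))"
    by (rule suminf_finite) (auto simp: hausdorff_outer_empty)
  finally show ?thesis by simp
qed

lemma hausdorff_outer_separated:
  assumes r: "0 < r" and sep: "\<And>x y. x \<in> A \<Longrightarrow> y \<in> B \<Longrightarrow> r \<le> dist x y"
  shows "hausdorff_outer m A + hausdorff_outer m B \<le> hausdorff_outer m (A \<union> B)"
proof -
  have small: "hausdorff_content m e A + hausdorff_content m e B \<le> hausdorff_content m e (A \<union> B)"
    if e: "e < r" for e
    unfolding hausdorff_content_def[of m e "A \<union> B"]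
  proof (rule INF_greatest, clarify)
    fix C :: "nat \<Rightarrow> 'a set"
    assume C: "A \<union> B \<subseteq> (\<Union>i. C i)" "\<forall>i. bounded (C i) \<and> diameter (C i) \<le> e"
    define CA where "CA i = (if C i \<inter> A = {} then {} else C i)" for i
    define CB where "CB i = (if C i \<inter> B = {} then {} else C i)" for i
    have dis: "CA i = {} \<or> CB i = {}" for i
    proof (rule ccontr)
      assume "\<not> ?thesis"
      then obtain x y where "x \<in> C i" "x \<in> A" "y \<in> C i" "y \<in> B"
        by (auto simp: CA_def CB_def split: if_splits)
      then have "r \<le> e"
        using sep[of x y] diameter_bounded_bound[of "C i" x y] C(2)[rule_format, of i] by linarith
      then show False using e by simp
    qed
    have e0: "e \<ge> 0" using C(2) diameter_ge_0[of "C 0"] by (meson order_trans)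
    have "hausdorff_content m e A \<le> (\<Sum>i. hausdorff_weight m (CA i))"
    proof (rule hausdorff_content_le)
      show "A \<subseteq> (\<Union>i. CA i)"
      proof
        fix x assume "x \<in> A"
        moreover from this obtain i where "x \<in> C i" using C(1) by blast
        ultimately have "x \<in> CA i" by (auto simp: CA_def)
        then show "x \<in> (\<Union>i. CA i)" by blast
      qed
    qed (use C(2) e0 in \<open>auto simp: CA_def\<close>)
    moreover have "hausdorff_content m e B \<le> (\<Sum>i. hausdorff_weight m (CB i))"
    proof (rule hausdorff_content_le)
      show "B \<subseteq> (\<Union>i. CB i)"
      proof
        fix x assume "x \<in> B"
        moreover from this obtain i where "x \<in> C i" using C(1) by blast
        ultimately have "x \<in> CB i" by (auto simp: CB_def)
        then show "x \<in> (\<Union>i. CB i)" by blast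
      qed
    qed (use C(2) e0 in \<open>auto simp: CB_def\<close>)
    ultimately have "hausdorff_content m e A + hausdorff_content m e B
        \<le> (\<Sum>i. hausdorff_weight m (CA i)) + (\<Sum>i. hausdorff_weight m (CB i))"
      by (rule add_mono)
    also have "\<dots> = (\<Sum>i. hausdorff_weight m (CA i) + hausdorff_weight m (CB i))"
      by (rule suminf_add) auto
    also have "\<dots> \<le> (\<Sum>i. hausdorff_weight m (C i))"
    proof (intro suminf_le)
      fix i show "hausdorff_weight m (CA i) + hausdorff_weight m (CB i) \<le> hausdorff_weight m (C i)"
        using dis[of i] by (auto simp: CA_def CB_def hausdorff_weight_def split: if_splits)
    qed auto
    finally show "hausdorff_content m e A + hausdorff_content m e B \<le> (\<Sum>i. hausdorff_weight m (C i))" .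
  qed
  have "hausdorff_content m e1 A + hausdorff_content m e2 B \<le> hausdorff_outer m (A \<union> B)"
    if "0 < e1" "0 < e2" for e1 e2
  proof -
    let ?e = "min (min e1 e2) (r / 2)"
    have "hausdorff_content m e1 A + hausdorff_content m e2 B
        \<le> hausdorff_content m ?e A + hausdorff_content m ?e B"
      by (intro add_mono hausdorff_content_mono) auto
    also have "\<dots> \<le> hausdorff_content m ?e (A \<union> B)" using r by (intro small) auto
    also have "\<dots> \<le> hausdorff_outer m (A \<union> B)"
      using that r by (intro hausdorff_content_le_outer) auto
    finally show ?thesis .
  qed
  then have "hausdorff_content m e1 A + hausdorff_outer m B \<le> hausdorff_outer m (A \<union> B)" if "0 < e1" for e1
    unfolding hausdorff_outer_def[of m B] using that
    by (subst ennreal_SUP_add_right) (auto intro!: SUP_least)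
  then show ?thesis
    unfolding hausdorff_outer_def[of m A]
    by (subst ennreal_SUP_add_left[symmetric]) (auto intro!: SUP_least)
qed

lemma hausdorff_outer_caratheodory:
  assumes F: "closed F"
  shows "hausdorff_outer m (Z \<inter> F) + hausdorff_outer m (Z - F) \<le> hausdorff_outer m Z"
proof (cases "F = {} \<or> hausdorff_outer m Z = top")
  case True
  then show ?thesis
  proof
    assume "F = {}" then show ?thesis by (simp add: hausdorff_outer_empty)
  next
    assume "hausdorff_outer m Z = top" then show ?thesis by (simp only: top_greatest)
  qed
next
  case False
  then have ne: "F \<noteq> {}" and fin: "hausdorff_outer m Z < top"
    by (simp_all only: de_Morgan_disj top.not_eq_extremum simp_thms)
  let ?H = "hausdorff_outer m" and ?d = "\<lambda>x. infdist x F"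
  define W where "W k = {z \<in> Z. 1 / (real k + 1) \<le> ?d z}" for k
  define R where "R k = {z \<in> Z. 1 / (real k + 2) \<le> ?d z \<and> ?d z < 1 / (real k + 1)}" for k
  have sep: "?H A + ?H B \<le> ?H (A \<union> B)"
    if "a < b" "\<And>x. x \<in> A \<Longrightarrow> b \<le> ?d x" "\<And>y. y \<in> B \<Longrightarrow> ?d y \<le> a" for A B and a b :: real
  proof (rule hausdorff_outer_separated)
    show "0 < b - a" using that(1) by simp
    fix x y assume "x \<in> A" "y \<in> B"
    then show "b - a \<le> dist x y"
      using that(2)[of x] that(3)[of y] infdist_triangle[of x F y] by linarith
  qed
  have alternate: "(\<Sum>i<n. ?H (R (2 * i + c))) \<le> ?H (\<Union>i<n. R (2 * i + c))" for n c
  proof (induction n)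
    case (Suc n)
    have "(\<Sum>i<Suc n. ?H (R (2 * i + c))) \<le> ?H (\<Union>i<n. R (2 * i + c)) + ?H (R (2 * n + c))"
      using Suc by (simp add: add_right_mono)
    also have "\<dots> \<le> ?H ((\<Union>i<n. R (2 * i + c)) \<union> R (2 * n + c))"
    proof (cases "n = 0")
      case False
      show ?thesis
      proof (rule sep)
        show "1 / (real (2 * n + c) + 1) < 1 / real (2 * n + c)"
          using False by (simp add: field_simps)
        fix x assume "x \<in> (\<Union>i<n. R (2 * i + c))"
        then obtain i where i: "i < n" "1 / (real (2 * i + c) + 2) \<le> ?d x" by (auto simp: R_def)
        have "1 / real (2 * n + c) \<le> 1 / (real (2 * i + c) + 2)"
          using i(1) by (intro divide_left_mono) auto
        then show "1 / real (2 * n + c) \<le> ?d x" using i(2) by linarith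
      next
        fix y assume "y \<in> R (2 * n + c)"
        then show "?d y \<le> 1 / (real (2 * n + c) + 1)" by (auto simp: R_def)
      qed
    qed (simp add: hausdorff_outer_empty)
    also have "(\<Union>i<n. R (2 * i + c)) \<union> R (2 * n + c) = (\<Union>i<Suc n. R (2 * i + c))"
      by (auto simp: lessThan_Suc)
    finally show ?case .
  qed (simp add: hausdorff_outer_empty)
  have "(\<Sum>i<n. ?H (R i)) \<le> 2 * ?H Z" for n
  proof -
    have "(\<Sum>i<n. ?H (R i)) \<le> (\<Sum>i<2 * n. ?H (R i))"
      by (rule sum_mono2) auto
    also have "\<dots> = (\<Sum>i<n. ?H (R (2 * i + 0))) + (\<Sum>i<n. ?H (R (2 * i + 1)))"
      by (induction n) (simp_all add: ac_simps)
    also have "\<dots> \<le> ?H Z + ?H Z"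
      by (intro add_mono order_trans[OF alternate] hausdorff_outer_mono) (auto simp: R_def)
    finally show ?thesis by (simp add: mult_2)
  qed
  then have "(\<Sum>i. ?H (R i)) \<le> 2 * ?H Z" by (intro suminf_le_const) auto
  also have "\<dots> < top" using fin by (simp add: ennreal_mult_less_top)
  finally have sumfin: "(\<Sum>i. ?H (R i)) < top" .
  define b where "b i = enn2real (?H (R i))" for i
  have Hb: "?H (R i) = ennreal (b i)" for i
    using ennreal_suminf_lessD[OF sumfin] by (simp add: b_def)
  have b0: "0 \<le> b i" for i by (simp add: b_def)
  have summable: "summable b"
    using sumfin unfolding Hb by (intro summable_suminf_not_top b0) auto
  show ?thesis
  proof (rule ennreal_le_epsilon)
    fix e :: real assume "0 < e"
    with suminf_exist_split2[OF summable] have "eventually (\<lambda>k. (\<Sum>i. b (i + k)) < e) sequentially"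
      by (rule order_tendstoD)
    then obtain k where k: "(\<Sum>i. b (i + k)) < e" by (auto simp: eventually_sequentially)
    have cover: "Z - F \<subseteq> W k \<union> (\<Union>i. R (i + k))"
    proof
      fix z assume z: "z \<in> Z - F"
      then have pos: "0 < ?d z" 
        using in_closed_iff_infdist_zero[OF F ne, of z] infdist_nonneg[of z F] by auto
      show "z \<in> W k \<union> (\<Union>i. R (i + k))"
      proof (cases "z \<in> W k")
        case False
        obtain j where "1 / ?d z < real j" using reals_Archimedean2 by blast
        then have ex: "1 / (real j + 1) \<le> ?d z" using pos by (simp add: field_simps)
        define l where "l = (LEAST j. 1 / (real j + 1) \<le> ?d z)"
        have l: "1 / (real l + 1) \<le> ?d z" unfolding l_def by (rule LeastI[of _ j]) (rule ex)
        have min: "\<not> 1 / (real i + 1) \<le> ?d z" if "i < l" for i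
          using that unfolding l_def by (rule not_less_Least)
        have nk: "\<not> 1 / (real k + 1) \<le> ?d z" using False z by (auto simp: W_def)
        have "k < l"
        proof (rule ccontr)
          assume "\<not> k < l"
          then have "1 / (real k + 1) \<le> 1 / (real l + 1)" by (intro divide_left_mono) auto
          with l nk show False by linarith
        qed
        then obtain i where i: "l = Suc (i + k)" by (metis add.commute less_imp_Suc_add)
        have "z \<in> R (i + k)" using z l min[of "i + k"] i by (auto simp: R_def algebra_simps)
        then show ?thesis by blast
      qed simp
    qed
    have "?H (Z - F) \<le> ?H (W k) + ?H (\<Union>i. R (i + k))"
      by (rule order_trans[OF hausdorff_outer_mono[OF cover] hausdorff_outer_Un])
    also have "?H (\<Union>i. R (i + k)) \<le> (\<Sum>i. ?H (R (i + k)))" by (rule hausdorff_outer_subadditive)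
    also have "\<dots> = ennreal (\<Sum>i. b (i + k))"
      unfolding Hb using summable by (intro suminf_ennreal2) (auto simp: b0 summable_iff_shift)
    also have "\<dots> \<le> ennreal e" using k by (intro ennreal_leI) simp
    finally have "?H (Z - F) \<le> ?H (W k) + ennreal e" by (simp add: add_left_mono)
    then have "?H (Z \<inter> F) + ?H (Z - F) \<le> (?H (W k) + ?H (Z \<inter> F)) + ennreal e"
      using add_left_mono[of _ _ "?H (Z \<inter> F)"] by (simp add: ac_simps)
    also have "?H (W k) + ?H (Z \<inter> F) \<le> ?H (W k \<union> (Z \<inter> F))"
      by (rule sep[of 0 "1 / (real k + 1)"]) (auto simp: W_def)
    also have "?H (W k \<union> (Z \<inter> F)) \<le> ?H Z" by (rule hausdorff_outer_mono) (auto simp: W_def)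
    finally show "?H (Z \<inter> F) + ?H (Z - F) \<le> ?H Z + ennreal e" by (simp add: add_right_mono)
  qed
qed

lemma emeasure_hausdorff_measure:
  assumes "A \<in> sets borel" shows "emeasure (hausdorff_measure m) A = hausdorff_outer m A"
proof -
  interpret P: sigma_algebra UNIV "Pow UNIV :: 'a set set" by (rule sigma_algebra_Pow)
  let ?L = "lambda_system UNIV (Pow UNIV :: 'a set set) (hausdorff_outer m)"
  have "outer_measure_space (Pow UNIV :: 'a set set) (hausdorff_outer m)"
    by (auto simp: outer_measure_space_def positive_def increasing_def countably_subadditive_def
        hausdorff_outer_empty hausdorff_outer_mono hausdorff_outer_subadditive)
  then have L: "measure_space UNIV ?L (hausdorff_outer m)" by (rule P.caratheodory_lemma)
  have "F \<in> ?L" if "closed F" for F :: "'a set"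
  proof -
    have "hausdorff_outer m (Z \<inter> F) + hausdorff_outer m (Z - F) = hausdorff_outer m Z" for Z
      using hausdorff_outer_caratheodory[OF that, of m Z]
        hausdorff_outer_Un[of m "Z \<inter> F" "Z - F"] by (simp add: Int_Diff_Un order_antisym)
    then show ?thesis unfolding P.lambda_system_eq by blast
  qed
  then have "Collect closed \<subseteq> ?L" by blast
  then have sub: "sets borel \<subseteq> ?L"
    using L sigma_algebra.sigma_sets_subset[of UNIV ?L "Collect closed"]
    unfolding borel_eq_closed measure_space_def by simp
  have sa: "sigma_algebra UNIV (sets (borel :: 'a measure))"
    by (metis sets.sigma_algebra_axioms space_borel)
  from measure_down[OF L sa sub] show ?thesis
    unfolding hausdorff_measure_def measure_space_def
    using assms emeasure_measure_of_sigma by blast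
qed

definition surface_measure :: "'a::euclidean_space measure" where
  "surface_measure = hausdorff_measure (DIM('a) - 1)"

text \<open>\<open>\<nu>\<close> is the unit outward normal at \<open>x\<close>: close to \<open>x\<close>, every closed cone
  around \<open>-\<nu>\<close> of opening less than a half-space lies in \<open>V\<close> and every such cone around \<open>\<nu>\<close> outside.\<close>

definition outward_unit_normal :: "'a::euclidean_space set \<Rightarrow> 'a \<Rightarrow> 'a \<Rightarrow> bool" where
  "outward_unit_normal V x \<nu> \<longleftrightarrow> norm \<nu> = 1 \<and>
     (\<forall>e>0. \<exists>d>0. \<forall>y. 0 < dist y x \<and> dist y x < d \<longrightarrow>
        ((y - x) \<bullet> \<nu> \<le> - e * dist y x \<longrightarrow> y \<in> V) \<and>
        ((y - x) \<bullet> \<nu> \<ge> e * dist y x \<longrightarrow> y \<notin> V))"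

definition divergence :: "('a::euclidean_space \<Rightarrow> 'a) \<Rightarrow> 'a \<Rightarrow> real" where
  "divergence G x = (\<Sum>b\<in>Basis. frechet_derivative G (at x) b \<bullet> b)"

definition lipschitz_field :: "'a::metric_space set \<Rightarrow> ('a \<Rightarrow> 'b::metric_space) \<Rightarrow> bool" where
  "lipschitz_field S g \<longleftrightarrow> (\<exists>L. lipschitz_on L S g)"

text \<open>A bounded region with unit outward normal \<open>n\<close> (which may be arbitrary on a null set of
  edges and corners) that is regular enough for the divergence theorem; this covers Lipschitz domains.
  Lipschitz rather than \<open>C\<^sup>1\<close> vector fields are used because, for the Dirac delta function,
  the second derivatives of the velocity jump across the surface of the body.\<close>

definition divergence_theorem_region :: "'a::euclidean_space set \<Rightarrow> ('a \<Rightarrow> 'a) \<Rightarrow> bool" where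
  "divergence_theorem_region V n \<longleftrightarrow>
     bounded V \<and> V \<in> sets lebesgue \<and>
     (AE x in surface_measure. x \<in> frontier V \<longrightarrow> outward_unit_normal V x (n x)) \<and>
     (\<forall>G. lipschitz_field (closure V) G \<longrightarrow>
        set_integrable lebesgue V (divergence G) \<and>
        set_integrable surface_measure (frontier V) (\<lambda>x. G x \<bullet> n x) \<and>
        (LINT x:V|lebesgue. divergence G x) = (LINT x:frontier V|surface_measure. G x \<bullet> n x))"

section \<open>Differential operators of the flow equations\<close>

definition gradient :: "('a::euclidean_space \<Rightarrow> real) \<Rightarrow> 'a \<Rightarrow> 'a" where
  "gradient g x = (\<Sum>b\<in>Basis. frechet_derivative g (at x) b *\<^sub>R b)"

definition laplacian :: "('a::euclidean_space \<Rightarrow> 'a) \<Rightarrow> 'a \<Rightarrow> 'a" where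
  "laplacian v x =
     (\<Sum>b\<in>Basis. frechet_derivative (\<lambda>y. frechet_derivative v (at y) b) (at x) b)"

text \<open>\<open>(v \<cdot> \<nabla>) v\<close>\<close>

definition convection :: "('a::euclidean_space \<Rightarrow> 'a) \<Rightarrow> 'a \<Rightarrow> 'a" where
  "convection v x = frechet_derivative v (at x) (v x)"

definition time_deriv :: "(real \<Rightarrow> 'a \<Rightarrow> 'b::real_normed_vector) \<Rightarrow> real \<Rightarrow> 'a \<Rightarrow> 'b" where
  "time_deriv v t x = vector_derivative (\<lambda>\<tau>. v \<tau> x) (at t)"

text \<open>The contraction \<open>\<nu> \<cdot> T\<close> of the (symmetric) viscous stress
  \<open>T = \<mu> (\<nabla>v + \<nabla>v\<^sup>T)\<close>.\<close>

definition viscous_traction :: "real \<Rightarrow> ('a::euclidean_space \<Rightarrow> 'a) \<Rightarrow> 'a \<Rightarrow> 'a \<Rightarrow> 'a" where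
  "viscous_traction \<mu> v x \<nu> =
     \<mu> *\<^sub>R (frechet_derivative v (at x) \<nu> + adjoint (frechet_derivative v (at x)) \<nu>)"

text \<open>\<open>\<nu> \<cdot> (- q I - v \<rho> v + T)\<close>\<close>

definition momentum_flux ::
    "real \<Rightarrow> real \<Rightarrow> ('a::euclidean_space \<Rightarrow> 'a) \<Rightarrow> ('a \<Rightarrow> real) \<Rightarrow> 'a \<Rightarrow> 'a \<Rightarrow> 'a" where
  "momentum_flux \<rho> \<mu> v q x \<nu> =
     - (q x *\<^sub>R \<nu>) - (\<rho> * (\<nu> \<bullet> v x)) *\<^sub>R v x + viscous_traction \<mu> v x \<nu>"

definition wedge2 :: "real^2 \<Rightarrow> real^2 \<Rightarrow> real" where
  "wedge2 a b = a $ 1 * b $ 2 - a $ 2 * b $ 1"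

section \<open>Dirac and regularized delta functions\<close>

datatype 'a delta_function = Dirac | Regularized "'a \<Rightarrow> real"

text \<open>The regularized kernels include Peskin's, see \<open>admissible_peskin_delta\<close> below.\<close>

fun admissible_delta :: "'a::euclidean_space delta_function \<Rightarrow> bool" where
  "admissible_delta Dirac \<longleftrightarrow> True"
| "admissible_delta (Regularized k) \<longleftrightarrow>
     continuous_on UNIV k \<and> (\<forall>z. 0 \<le> k z) \<and> (\<forall>z. k (- z) = k z) \<and>
     bounded {z. k z \<noteq> 0} \<and> (LINT z|lebesgue. k z) = 1"

text \<open>\<open>delta_integral \<delta> \<Omega> y g\<close> is \<open>\<integral>\<^sub>\<Omega> g(x) \<delta>(x - y) dx\<close>.\<close>

fun delta_integral ::
    "'a::euclidean_space delta_function \<Rightarrow> 'a set \<Rightarrow> 'a \<Rightarrow> ('a \<Rightarrow> 'b::euclidean_space) \<Rightarrow> 'b" where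
  "delta_integral Dirac \<Omega> y g = indicator \<Omega> y *\<^sub>R g y"
| "delta_integral (Regularized k) \<Omega> y g = (LINT x:\<Omega>|lebesgue. k (x - y) *\<^sub>R g x)"

text \<open>\<open>f(x) = \<integral>\<^sub>U F(s) \<delta>(x - Y(s)) ds\<close> on \<open>\<Omega>\<close>; for the Dirac delta function
  this is an identity of distributions.\<close>

fun spread_force ::
    "'a::euclidean_space delta_function \<Rightarrow> 'a set \<Rightarrow> 'a set \<Rightarrow> ('a \<Rightarrow> 'a) \<Rightarrow> ('a \<Rightarrow> 'a) \<Rightarrow> ('a \<Rightarrow> 'a) \<Rightarrow> bool" where
  "spread_force Dirac \<Omega> U F Y f \<longleftrightarrow>
     set_integrable lebesgue \<Omega> f \<and>
     (\<forall>\<phi> :: 'a \<Rightarrow> real. continuous_on UNIV \<phi> \<and> bounded {x. \<phi> x \<noteq> 0} \<longrightarrow>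
        (LINT x:\<Omega>|lebesgue. \<phi> x *\<^sub>R f x) = (LINT s:U|lebesgue. \<phi> (Y s) *\<^sub>R F s))"
| "spread_force (Regularized k) \<Omega> U F Y f \<longleftrightarrow>
     (\<forall>x\<in>\<Omega>. f x = (LINT s:U|lebesgue. k (x - Y s) *\<^sub>R F s))"

text \<open>Peskin's 4-point kernel with mesh width \<open>h\<close>.\<close>

definition peskin_phi :: "real \<Rightarrow> real" where
  "peskin_phi r =
     (if \<bar>r\<bar> \<le> 1 then (3 - 2 * \<bar>r\<bar> + sqrt (1 + 4 * \<bar>r\<bar> - 4 * r\<^sup>2)) / 8
      else if \<bar>r\<bar> \<le> 2 then (5 - 2 * \<bar>r\<bar> - sqrt (- 7 + 12 * \<bar>r\<bar> - 4 * r\<^sup>2)) / 8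
      else 0)"

definition peskin_delta :: "real \<Rightarrow> 'a::euclidean_space \<Rightarrow> real" where
  "peskin_delta h x = (\<Prod>b\<in>Basis. peskin_phi ((x \<bullet> b) / h) / h)"

lemma peskin_phi_minus [simp]: "peskin_phi (- r) = peskin_phi r"
  by (simp add: peskin_phi_def)

lemma peskin_phi_nonneg [simp]: "0 \<le> peskin_phi r"
proof -
  have "0 \<le> (3 - 2 * \<bar>r\<bar> + sqrt (1 + 4 * \<bar>r\<bar> - 4 * r\<^sup>2)) / 8" if "\<bar>r\<bar> \<le> 1"
  proof -
    have "r\<^sup>2 \<le> \<bar>r\<bar>"
      using that mult_left_le[of "\<bar>r\<bar>" "\<bar>r\<bar>"] by (simp add: power2_eq_square)
    then show ?thesis using that by simp
  qed
  moreover have "0 \<le> (5 - 2 * \<bar>r\<bar> - sqrt (- 7 + 12 * \<bar>r\<bar> - 4 * r\<^sup>2)) / 8" if "\<bar>r\<bar> \<le> 2"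
  proof -
    have "0 \<le> (\<bar>r\<bar> - 2)\<^sup>2" by simp
    then have "- 7 + 12 * \<bar>r\<bar> - 4 * r\<^sup>2 \<le> (5 - 2 * \<bar>r\<bar>)\<^sup>2"
      by (simp add: power2_eq_square algebra_simps)
    then have "sqrt (- 7 + 12 * \<bar>r\<bar> - 4 * r\<^sup>2) \<le> 5 - 2 * \<bar>r\<bar>"
      using that by (intro real_le_lsqrt) auto
    then show ?thesis by simp
  qed
  ultimately show ?thesis by (simp add: peskin_phi_def)
qed

lemma peskin_phi_eq_0: "2 < \<bar>r\<bar> \<Longrightarrow> peskin_phi r = 0"
  by (simp add: peskin_phi_def)

lemma continuous_peskin_phi: "continuous_on UNIV peskin_phi"
proof -
  define A where "A a = (3 - 2 * a + sqrt (1 + 4 * a - 4 * a\<^sup>2)) / 8" for a :: real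
  define B where "B a = (5 - 2 * a - sqrt (- 7 + 12 * a - 4 * a\<^sup>2)) / 8" for a :: real
  have eq: "peskin_phi = (\<lambda>r. A (min \<bar>r\<bar> 1) + B (max 1 (min \<bar>r\<bar> 2)) - 1 / 4)"
    by (auto simp: fun_eq_iff peskin_phi_def A_def B_def min_def max_def)
  have cont: "continuous_on UNIV (\<lambda>r. A (min \<bar>r\<bar> 1) + B (max 1 (min \<bar>r\<bar> 2)) - 1 / 4)"
    unfolding A_def B_def by (intro continuous_intros) auto
  show ?thesis by (subst eq) (rule cont)
qed

lemma peskin_phi_measurable [measurable]: "peskin_phi \<in> borel_measurable borel"
  by (rule borel_measurable_continuous_onI[OF continuous_peskin_phi])

lemma peskin_phi_reflect:
  assumes "0 \<le> r" "r \<le> 2" shows "peskin_phi r + peskin_phi (2 - r) = 1 / 2"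
proof -
  have *: "peskin_phi r + peskin_phi (2 - r) = 1 / 2" if "0 \<le> r" "r < 1" for r
  proof -
    have "- 7 + 12 * (2 - r) - 4 * (2 - r)\<^sup>2 = 1 + 4 * r - 4 * r\<^sup>2"
      by (simp add: power2_eq_square algebra_simps)
    then show ?thesis using that by (simp add: peskin_phi_def field_simps)
  qed
  consider "r < 1" | "r = 1" | "2 - r < 1" by linarith
  then show ?thesis
  proof cases
    case 1 then show ?thesis using * assms by simp
  next
    case 2 then show ?thesis by (simp add: peskin_phi_def)
  next
    case 3 then show ?thesis using *[of "2 - r"] assms by simp
  qed
qed

lemma peskin_phi_integral: "integrable lborel peskin_phi" "(LINT r|lborel. peskin_phi r) = 1"
proof -
  have int: "set_integrable lborel S peskin_phi" if "S \<subseteq> {-2..2}" "S \<in> sets lborel" for S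
  proof (rule set_integrable_subset[OF _ _ that(1)])
    show "set_integrable lborel {-2..2} peskin_phi"
      by (rule borel_integrable_atLeastAtMost') (rule continuous_on_subset[OF continuous_peskin_phi], simp)
  qed (use that in auto)
  have split: "peskin_phi r = indicator {0..2} r * peskin_phi r + indicator {-2..<0} r * peskin_phi r" for r
    using peskin_phi_eq_0[of r] by (cases "2 < \<bar>r\<bar>") (auto simp: indicator_def)
  have i1: "integrable lborel (\<lambda>r. indicator {0..2} r * peskin_phi r)"
    and i2: "integrable lborel (\<lambda>r. indicator {-2..<0} r * peskin_phi r)"
    using int[of "{0..2}"] int[of "{-2..<0}"] by (simp_all add: set_integrable_def subset_eq)
  show "integrable lborel peskin_phi"
    by (subst split[abs_def]) (intro Bochner_Integration.integrable_add i1 i2)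
  let ?I = "LINT r|lborel. indicator {0..2} r * peskin_phi r"
  have r1: "?I = (LINT r|lborel. indicator {0..2} r * peskin_phi (2 - r))"
    by (subst lborel_integral_real_affine[where c="-1" and t=2])
       (auto intro!: Bochner_Integration.integral_cong split: split_indicator)
  have i3: "integrable lborel (\<lambda>r. indicator {0..2} r * peskin_phi (2 - r))"
    using lborel_integrable_real_affine[OF i1, of "-1" 2]
    by (rule back_subst[where P="integrable lborel"]) (auto split: split_indicator)
  have "?I + ?I = (LINT r|lborel. indicator {0..2} r * peskin_phi r + indicator {0..2} r * peskin_phi (2 - r))"
    by (subst (2) r1, subst Bochner_Integration.integral_add[OF i1 i3]) simp
  also have "\<dots> = (LINT r|lborel. indicator {0..2::real} r * (1 / 2))"
    by (rule Bochner_Integration.integral_cong)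
       (auto split: split_indicator dest: peskin_phi_reflect)
  also have "\<dots> = 1" by simp
  finally have I: "?I = 1 / 2" by simp
  have "(LINT r|lborel. indicator {-2..<0} r * peskin_phi r) = (LINT r|lborel. indicator {0<..2} r * peskin_phi r)"
    by (subst lborel_integral_real_affine[where c="-1" and t=0])
       (auto intro!: Bochner_Integration.integral_cong split: split_indicator)
  also have "\<dots> = ?I"
    using AE_lborel_singleton[of "0::real"]
    by (intro integral_cong_AE) (auto split: split_indicator)
  finally have J: "(LINT r|lborel. indicator {-2..<0} r * peskin_phi r) = 1 / 2" using I by simp
  show "(LINT r|lborel. peskin_phi r) = 1"
    by (subst split[abs_def]) (simp add: Bochner_Integration.integral_add[OF i1 i2] I J)
qed

lemma peskin_delta_integral:
  assumes "0 < h" shows "(LINT x|lebesgue. peskin_delta h (x :: 'a::euclidean_space)) = 1"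
proof -
  have meas [measurable]: "peskin_delta h \<in> borel_measurable (borel :: 'a measure)"
    unfolding peskin_delta_def by measurable
  have nn: "0 \<le> peskin_delta h x" for x :: 'a
    using assms by (auto simp: peskin_delta_def intro!: prod_nonneg)
  have "(LINT r|lborel. peskin_phi (r / h) / h) = 1"
    using assms lborel_integral_real_affine[where c="1/h" and t=0 and f=peskin_phi]
    by (simp add: peskin_phi_integral)
  moreover have "integrable lborel (\<lambda>r. peskin_phi (r / h) / h)"
    using assms lborel_integrable_real_affine[OF peskin_phi_integral(1), of "1/h" 0] by simp
  ultimately have one: "(\<integral>\<^sup>+ r. ennreal (peskin_phi (r / h) / h) \<partial>lborel) = 1"
    using assms by (subst nn_integral_eq_integral) auto
  have "(\<integral>\<^sup>+ x. ennreal (peskin_delta h (x :: 'a)) \<partial>lborel)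
      = (\<integral>\<^sup>+ x. (\<Prod>b\<in>(Basis :: 'a set). ennreal (peskin_phi ((x \<bullet> b) / h) / h)) \<partial>lborel)"
    using assms by (simp add: peskin_delta_def prod_ennreal)
  also have "\<dots> = 1"
    using assms nn_integral_lborel_prod[where 'a='a and f="\<lambda>_ r. ennreal (peskin_phi (r / h) / h)"]
    by (simp add: one)
  finally have "(LINT x|lborel. peskin_delta h (x :: 'a)) = 1"
    by (subst integral_eq_nn_integral) (auto simp: nn)
  then show ?thesis by (simp add: integral_completion)
qed

lemma peskin_delta_support:
  assumes "0 < h" shows "bounded {z :: 'a::euclidean_space. peskin_delta h z \<noteq> 0}"
proof (rule boundedI)
  fix z :: 'a assume "z \<in> {z. peskin_delta h z \<noteq> 0}"
  then have "\<bar>z \<bullet> b\<bar> \<le> 2 * h" if "b \<in> Basis" for b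
    using that assms peskin_phi_eq_0[of "(z \<bullet> b) / h"]
    by (auto simp: peskin_delta_def field_simps not_le[symmetric])
  then show "norm z \<le> (\<Sum>b\<in>(Basis :: 'a set). 2 * h)"
    by (intro order_trans[OF norm_le_l1] sum_mono)
qed

lemma continuous_peskin_delta:
  assumes "0 < h" shows "continuous_on UNIV (peskin_delta h :: 'a::euclidean_space \<Rightarrow> real)"
  unfolding peskin_delta_def using assms
    by (intro continuous_intros continuous_on_compose2[OF continuous_peskin_phi]) auto

lemma admissible_peskin_delta:
  assumes "0 < h"
  shows "admissible_delta (Regularized (peskin_delta h :: 'a::euclidean_space \<Rightarrow> real))"
proof -
  have "0 \<le> peskin_delta h z" "peskin_delta h (- z) = peskin_delta h z" for z :: 'a
    using assms by (auto simp: peskin_delta_def intro!: prod_nonneg)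
  then show ?thesis
    using continuous_peskin_delta[OF assms] peskin_delta_support[OF assms]
      peskin_delta_integral[OF assms] by simp
qed

section \<open>Immersed body in a control volume\<close>

text \<open>In the fields below time is the first argument. \<open>wedge\<close> is \<^const>\<open>wedge2\<close> or
  \<^const>\<open>cross3\<close>; \<open>J\<close> is the set of times, \<open>U\<close> the Lagrangian domain,
  \<open>F\<close> the Lagrange multiplier, \<open>V\<close> the velocity of the material points,
  \<open>Vb\<close> the body and \<open>CV\<close> the control volume.\<close>

locale immersed_body_cv =
  fixes wedge :: "'a::euclidean_space \<Rightarrow> 'a \<Rightarrow> 'w::euclidean_space"
    and \<Omega> :: "'a set" and J :: "real set" and \<rho> \<mu> :: real
    and u :: "real \<Rightarrow> 'a \<Rightarrow> 'a" and p :: "real \<Rightarrow> 'a \<Rightarrow> real" and f :: "real \<Rightarrow> 'a \<Rightarrow> 'a"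
    and \<delta> :: "'a delta_function"
    and U :: "'a set" and F X V :: "real \<Rightarrow> 'a \<Rightarrow> 'a"
    and Vb CV :: "real \<Rightarrow> 'a set" and n :: "real \<Rightarrow> 'a \<Rightarrow> 'a" and x0 :: "real \<Rightarrow> 'a"
  assumes domain: "open \<Omega>" and times: "open J"
    \<comment> \<open>momentum and continuity equations; the former may fail on a null set, where
      derivatives jump\<close>
    and continuity: "\<And>t x. t \<in> J \<Longrightarrow> x \<in> \<Omega> \<Longrightarrow> u t differentiable (at x) \<and> divergence (u t) x = 0"
    and momentum: "\<And>t. t \<in> J \<Longrightarrow> AE x in lebesgue. x \<in> \<Omega> \<longrightarrow>
      (\<lambda>\<tau>. u \<tau> x) differentiable (at t) \<and> p t differentiable (at x) \<and>
      (\<forall>b\<in>Basis. (\<lambda>y. frechet_derivative (u t) (at y) b) differentiable (at x)) \<and>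
      \<rho> *\<^sub>R (time_deriv u t x + convection (u t) x) =
        - gradient (p t) x + \<mu> *\<^sub>R laplacian (u t) x + f t x"
    \<comment> \<open>material points and rigidity constraint\<close>
    and lagrangian_domain: "U \<in> lmeasurable"
    and position: "\<And>t. t \<in> J \<Longrightarrow> continuous_on U (X t) \<and> inj_on (X t) U"
    and body: "\<And>t. t \<in> J \<Longrightarrow> Vb t = X t ` U"
    and velocity: "\<And>t s. t \<in> J \<Longrightarrow> s \<in> U \<Longrightarrow> ((\<lambda>\<tau>. X \<tau> s) has_vector_derivative V t s) (at t)"
    and interpolation: "\<And>t s. t \<in> J \<Longrightarrow> s \<in> U \<Longrightarrow> V t s = delta_integral \<delta> \<Omega> (X t s) (u t)"
    and no_slip: "\<And>t s. t \<in> J \<Longrightarrow> s \<in> U \<Longrightarrow> X t s \<in> frontier (Vb t) \<Longrightarrow> u t (X t s) = V t s"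
    and rigidity: "\<And>t t' s s'. t \<in> J \<Longrightarrow> t' \<in> J \<Longrightarrow> s \<in> U \<Longrightarrow> s' \<in> U \<Longrightarrow>
      dist (X t s) (X t s') = dist (X t' s) (X t' s')"
    \<comment> \<open>force density\<close>
    and delta: "admissible_delta \<delta>"
    and delta_mass: "\<And>t s. t \<in> J \<Longrightarrow> s \<in> U \<Longrightarrow> delta_integral \<delta> \<Omega> (X t s) (\<lambda>x. 1 :: real) = 1"
    and multiplier: "\<And>t. t \<in> J \<Longrightarrow> set_integrable lebesgue U (F t)"
    and force: "\<And>t. t \<in> J \<Longrightarrow> spread_force \<delta> \<Omega> U (F t) (X t) (f t)"
    \<comment> \<open>control volume; the support condition follows if \<open>f\<close> vanishes outside \<open>Vb\<close>, and
      also permits the slightly larger support given by a regularized delta function\<close>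
    and control_volume: "\<And>t. t \<in> J \<Longrightarrow> Vb t \<subseteq> CV t \<and> CV t \<subseteq> \<Omega>"
    and force_support: "\<And>t x. t \<in> J \<Longrightarrow> x \<in> \<Omega> \<Longrightarrow> x \<notin> CV t \<Longrightarrow> f t x = 0"
    and region: "\<And>t. t \<in> J \<Longrightarrow> divergence_theorem_region (CV t) (n t)"
    and regularity: "\<And>t. t \<in> J \<Longrightarrow>
      lipschitz_field (closure (CV t)) (p t) \<and> lipschitz_field (closure (CV t)) (u t) \<and>
      (\<forall>x\<in>closure (CV t). u t differentiable (at x)) \<and>
      (\<forall>b\<in>Basis. lipschitz_field (closure (CV t)) (\<lambda>x. frechet_derivative (u t) (at x) b))"
    \<comment> \<open>linear and angular momentum of the body in the Eulerian and Lagrangian descriptions\<close>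
    and momentum_integrable: "\<And>t. t \<in> J \<Longrightarrow>
      set_integrable lebesgue (Vb t) (u t) \<and> set_integrable lebesgue U (V t)"
    and linear_momentum: "\<And>t. t \<in> J \<Longrightarrow>
      (LINT x:Vb t|lebesgue. \<rho> *\<^sub>R u t x) = (LINT s:U|lebesgue. \<rho> *\<^sub>R V t s)"
    and angular_momentum: "\<And>t. t \<in> J \<Longrightarrow>
      (LINT x:Vb t|lebesgue. \<rho> *\<^sub>R wedge (x - x0 t) (u t x)) =
      (LINT s:U|lebesgue. \<rho> *\<^sub>R wedge (X t s - x0 t) (V t s))"
    and linear_momentum_differentiable: "\<And>t. t \<in> J \<Longrightarrow>
      (\<lambda>\<tau>. LINT x:Vb \<tau>|lebesgue. \<rho> *\<^sub>R u \<tau> x) differentiable (at t)"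
    and angular_momentum_differentiable: "\<And>t. t \<in> J \<Longrightarrow>
      (\<lambda>\<tau>. LINT x:Vb \<tau>|lebesgue. \<rho> *\<^sub>R wedge (x - x0 \<tau>) (u \<tau> x)) differentiable (at t)"

end

theory Submission
  imports Defs
begin

text \<open>Principle of virtual work. Test the momentum equation with an infinitesimal rigid motion
  \<open>\<kappa>(x) = a + A x\<close>, \<open>A\<close> antisymmetric. As the stress
  \<open>\<sigma> = - p I - u \<rho> u + T\<close> is symmetric, the divergence of \<open>\<sigma> \<kappa>\<close> is
  \<open>\<kappa> \<bullet> (\<rho> \<partial>\<^sub>t u - f)\<close> almost everywhere, so the divergence theorem yields the control
  volume expression for the work of \<open>f\<close>. The delta function reproduces affine functions, hence this
  work equals \<open>\<integral>\<^sub>U \<kappa>(X) \<bullet> F ds\<close>. Constant \<open>\<kappa>\<close> give the force balance, rotations about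
  \<open>x\<^sub>0\<close> the torque balance. The momenta of the body agree for all times in the two
  descriptions, and so do their time derivatives.\<close>

subsection \<open>Symmetry of second derivatives and divergence of the stress\<close>

text \<open>The mean value theorem along \<open>b\<close> turns the mixed second difference into a
  difference of two values of \<open>g' y b\<close>, and linearising these at \<open>x\<close>
  leaves \<open>B c\<close>. Only differentiability of the first derivatives at the single point
  \<open>x\<close> is used, since the momentum equation grants second derivatives merely almost
  everywhere.\<close>

lemma second_difference_estimate:
  fixes g :: "'a::real_normed_vector \<Rightarrow> real"
  assumes S: "open S" "x \<in> S" and g: "\<And>y. y \<in> S \<Longrightarrow> (g has_derivative g' y) (at y)"
    and B: "((\<lambda>y. g' y b) has_derivative B) (at x)" and e: "0 < e"
  obtains d where "0 < d"
    "\<And>h. 0 < h \<Longrightarrow> h < d \<Longrightarrow>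
      \<bar>g (x + h *\<^sub>R b + h *\<^sub>R c) - g (x + h *\<^sub>R b) - g (x + h *\<^sub>R c) + g x - h\<^sup>2 * B c\<bar> \<le> e * h\<^sup>2"
proof -
  \<comment> \<open>All points of the parallelogram spanned by \<open>h *\<^sub>R b\<close> and
    \<open>h *\<^sub>R c\<close> lie within \<open>h * K\<close> of \<open>x\<close>; the summand 1
    keeps \<open>K\<close> positive when \<open>b\<close> and \<open>c\<close> vanish.\<close>
  define K where "K = norm b + norm c + 1"
  have K: "0 < K" by (simp add: K_def add_nonneg_pos)
  interpret B: bounded_linear B by (rule has_derivative_bounded_linear[OF B])
  \<comment> \<open>The linearisation is used at two points, each at distance at most
    \<open>h * K\<close> from \<open>x\<close>; this tolerance makes each contribute at most
    \<open>e / 2 * h\<close>.\<close>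
  have "0 < e / (2 * K)" using e K by simp
  then obtain d0 where d0: "0 < d0"
    "\<And>y. norm (y - x) < d0 \<Longrightarrow> norm (g' y b - g' x b - B (y - x)) \<le> e / (2 * K) * norm (y - x)"
    using B unfolding has_derivative_at_alt by blast
  obtain d1 where d1: "0 < d1" "ball x d1 \<subseteq> S"
    using S open_contains_ball by blast
  define d where "d = min d0 d1 / K"
  show thesis
  proof (rule that)
    show "0 < d" using d0 d1 K by (simp add: d_def)
    fix h :: real assume h: "0 < h" "h < d"
    have hK: "h * K < d0" "h * K < d1"
      using h K by (auto simp: d_def field_simps)
    have near: "norm (s *\<^sub>R b + r *\<^sub>R c) \<le> h * K" if "0 \<le> s" "s \<le> h" "0 \<le> r" "r \<le> h" for s r
    proof -
      have "norm (s *\<^sub>R b + r *\<^sub>R c) \<le> s * norm b + r * norm c"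
        using that norm_triangle_ineq[of "s *\<^sub>R b" "r *\<^sub>R c"] by simp
      also have "\<dots> \<le> h * norm b + h * norm c"
        using that by (intro add_mono mult_right_mono) auto
      also have "\<dots> \<le> h * K" using h by (simp add: K_def algebra_simps)
      finally show ?thesis .
    qed
    have inS: "x + s *\<^sub>R b + r *\<^sub>R c \<in> S" if "0 \<le> s" "s \<le> h" "0 \<le> r" "r \<le> h" for s r
    proof -
      have "dist x (x + s *\<^sub>R b + r *\<^sub>R c) < d1"
        using near[OF that] hK by (simp add: dist_norm add.assoc norm_minus_commute flip: norm_minus_cancel[of "s *\<^sub>R b + r *\<^sub>R c"])
      then show ?thesis using d1 by auto
    qed
    \<comment> \<open>The increment of \<open>\<phi>\<close> from 0 to \<open>h\<close> is the
      second difference. The term \<open>0 *\<^sub>R c\<close> gives both values of \<open>g\<close>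
      the same shape, with \<open>r = h\<close> and \<open>r = 0\<close>.\<close>
    define \<phi> where "\<phi> s = g (x + s *\<^sub>R b + h *\<^sub>R c) - g (x + s *\<^sub>R b + 0 *\<^sub>R c)" for s
    define \<phi>' where "\<phi>' s = g' (x + s *\<^sub>R b + h *\<^sub>R c) b - g' (x + s *\<^sub>R b + 0 *\<^sub>R c) b" for s
    have one: "((\<lambda>s. g (x + s *\<^sub>R b + r *\<^sub>R c)) has_real_derivative g' (x + s *\<^sub>R b + r *\<^sub>R c) b) (at s)"
      if "0 \<le> s" "s \<le> h" "0 \<le> r" "r \<le> h" for s r
    proof -
      have D: "(g has_derivative g' (x + s *\<^sub>R b + r *\<^sub>R c)) (at (x + s *\<^sub>R b + r *\<^sub>R c))"
        by (rule g[OF inS[OF that]])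
      interpret D: bounded_linear "g' (x + s *\<^sub>R b + r *\<^sub>R c)"
        by (rule has_derivative_bounded_linear[OF D])
      have "((\<lambda>s. x + s *\<^sub>R b + r *\<^sub>R c) has_derivative (\<lambda>s. s *\<^sub>R b)) (at s)"
        by (auto intro!: derivative_eq_intros)
      from diff_chain_at[OF this D] show ?thesis
        by (simp add: has_field_derivative_def o_def D.scaleR mult_commute_abs)
    qed
    have "(\<phi> has_real_derivative \<phi>' s) (at s)" if "0 \<le> s" "s \<le> h" for s
      unfolding \<phi>_def \<phi>'_def using that h by (intro DERIV_diff one) auto
    then obtain z where z: "0 < z" "z < h" "\<phi> h - \<phi> 0 = (h - 0) * \<phi>' z"
      using MVT2[of 0 h \<phi> \<phi>'] h by auto
    have est: "\<bar>g' (x + z *\<^sub>R b + r *\<^sub>R c) b - g' x b - B (z *\<^sub>R b + r *\<^sub>R c)\<bar> \<le> e / 2 * h"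
      if "0 \<le> r" "r \<le> h" for r
    proof -
      have n: "norm (z *\<^sub>R b + r *\<^sub>R c) \<le> h * K" by (rule near) (use z that in auto)
      have "\<bar>g' (x + z *\<^sub>R b + r *\<^sub>R c) b - g' x b - B (z *\<^sub>R b + r *\<^sub>R c)\<bar>
          \<le> e / (2 * K) * norm (z *\<^sub>R b + r *\<^sub>R c)"
        using d0(2)[of "x + z *\<^sub>R b + r *\<^sub>R c"] n hK by (simp add: add.assoc)
      also have "\<dots> \<le> e / (2 * K) * (h * K)"
        using n e K by (intro mult_left_mono) auto
      also have "\<dots> = e / 2 * h" using K by simp
      finally show ?thesis .
    qed
    \<comment> \<open>By linearity of \<open>B\<close>, the contributions of \<open>g' x b\<close>
      and of the unknown intermediate point \<open>z\<close> cancel in the difference of the two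
      estimates, and only \<open>B (h *\<^sub>R c)\<close> survives.\<close>
    have "\<bar>\<phi>' z - h * B c\<bar> \<le> e * h"
    proof -
      have "\<phi>' z - h * B c = (g' (x + z *\<^sub>R b + h *\<^sub>R c) b - g' x b - B (z *\<^sub>R b + h *\<^sub>R c))
          - (g' (x + z *\<^sub>R b + 0 *\<^sub>R c) b - g' x b - B (z *\<^sub>R b + 0 *\<^sub>R c))"
        by (simp add: \<phi>'_def B.add B.scaleR)
      also have "\<bar>\<dots>\<bar> \<le> e / 2 * h + e / 2 * h"
        by (rule order_trans[OF abs_triangle_ineq4 add_mono[OF est[of h] est[of 0]]]) (use h in auto)
      finally show ?thesis by simp
    qed
    then have "h * \<bar>\<phi>' z - h * B c\<bar> \<le> h * (e * h)" using h by (intro mult_left_mono) auto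
    moreover have "h * \<bar>\<phi>' z - h * B c\<bar> = \<bar>h * (\<phi>' z - h * B c)\<bar>"
      using h by (simp add: abs_mult)
    moreover have "h * (\<phi>' z - h * B c) = \<phi> h - \<phi> 0 - h\<^sup>2 * B c"
      by (simp add: z(3) power2_eq_square algebra_simps)
    ultimately show "\<bar>g (x + h *\<^sub>R b + h *\<^sub>R c) - g (x + h *\<^sub>R b) - g (x + h *\<^sub>R c) + g x - h\<^sup>2 * B c\<bar> \<le> e * h\<^sup>2"
      by (simp add: \<phi>_def power2_eq_square algebra_simps)
  qed
qed

text \<open>The second difference is unchanged when \<open>b\<close> and \<open>c\<close> are
  exchanged, so \<open>h\<^sup>2 * B c\<close> and \<open>h\<^sup>2 * C b\<close> approximate the
  same number up to an arbitrarily small multiple of \<open>h\<^sup>2\<close>.\<close>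

lemma second_derivative_symmetric:
  fixes g :: "'a::real_normed_vector \<Rightarrow> real"
  assumes S: "open S" "x \<in> S" and g: "\<And>y. y \<in> S \<Longrightarrow> (g has_derivative g' y) (at y)"
    and B: "((\<lambda>y. g' y b) has_derivative B) (at x)"
    and C: "((\<lambda>y. g' y c) has_derivative C) (at x)"
  shows "B c = C b"
proof -
  have "\<bar>B c - C b\<bar> \<le> e" if e: "0 < e" for e
  proof -
    have e2: "0 < e / 2" using e by simp
    obtain d1 where d1: "0 < d1" "\<And>h. 0 < h \<Longrightarrow> h < d1 \<Longrightarrow>
      \<bar>g (x + h *\<^sub>R b + h *\<^sub>R c) - g (x + h *\<^sub>R b) - g (x + h *\<^sub>R c) + g x - h\<^sup>2 * B c\<bar> \<le> e / 2 * h\<^sup>2"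
      using second_difference_estimate[OF S g B e2] by blast
    obtain d2 where d2: "0 < d2" "\<And>h. 0 < h \<Longrightarrow> h < d2 \<Longrightarrow>
      \<bar>g (x + h *\<^sub>R c + h *\<^sub>R b) - g (x + h *\<^sub>R c) - g (x + h *\<^sub>R b) + g x - h\<^sup>2 * C b\<bar> \<le> e / 2 * h\<^sup>2"
      using second_difference_estimate[OF S g C e2] by blast
    define h where "h = min d1 d2 / 2"
    have h: "0 < h" "h < d1" "h < d2" using d1 d2 by (auto simp: h_def)
    have swap: "x + h *\<^sub>R c + h *\<^sub>R b = x + h *\<^sub>R b + h *\<^sub>R c" by simp
    have "\<bar>h\<^sup>2 * B c - h\<^sup>2 * C b\<bar> \<le> e * h\<^sup>2"
      using d1(2)[of h] d2(2)[of h] h unfolding swap by linarith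
    then have "h\<^sup>2 * \<bar>B c - C b\<bar> \<le> h\<^sup>2 * e"
      by (metis abs_mult abs_power2 mult.commute right_diff_distrib)
    then show ?thesis using h by simp
  qed
  then have "\<bar>B c - C b\<bar> \<le> 0" by (rule field_le_epsilon) simp
  then show ?thesis by simp
qed

section \<open>The stress tensor: basis expansion, symmetry and divergence\<close>

lemma viscous_traction_eq:
  assumes "v differentiable (at x)"
  shows "viscous_traction \<mu> v x \<nu> = \<mu> *\<^sub>R
    ((\<Sum>b\<in>Basis. (\<nu> \<bullet> b) *\<^sub>R frechet_derivative v (at x) b) +
     (\<Sum>b\<in>Basis. (\<nu> \<bullet> frechet_derivative v (at x) b) *\<^sub>R b))"
proof -
  let ?D = "frechet_derivative v (at x)"
  have lin: "linear ?D" by (rule linear_frechet_derivative[OF assms])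
  \<comment> \<open>Expanding in the basis removes the adjoint and leaves sums of products of
    fields, a form that suits both the product rule of differentiation and Lipschitz
    estimates.\<close>
  have "?D \<nu> = ?D (\<Sum>b\<in>Basis. (\<nu> \<bullet> b) *\<^sub>R b)" by (simp add: euclidean_representation)
  also have "\<dots> = (\<Sum>b\<in>Basis. (\<nu> \<bullet> b) *\<^sub>R ?D b)"
    by (simp add: linear_sum[OF lin] linear_cmul[OF lin])
  finally have 1: "?D \<nu> = (\<Sum>b\<in>Basis. (\<nu> \<bullet> b) *\<^sub>R ?D b)" .
  have "adjoint ?D \<nu> = (\<Sum>b\<in>Basis. (adjoint ?D \<nu> \<bullet> b) *\<^sub>R b)" by (simp add: euclidean_representation)
  also have "\<dots> = (\<Sum>b\<in>Basis. (\<nu> \<bullet> ?D b) *\<^sub>R b)"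
    using adjoint_works[OF lin] by (simp add: inner_commute)
  finally show ?thesis unfolding viscous_traction_def 1 by simp
qed

text \<open>Pressure, convective and viscous parts are each symmetric. This lets the flux of the
  field obtained by applying the stress to \<open>\<kappa>\<close> be read as
  \<open>\<kappa>\<close> paired with the traction on the surface.\<close>

lemma momentum_flux_symmetric:
  assumes "v differentiable (at x)"
  shows "momentum_flux \<rho> \<mu> v q x a \<bullet> c = momentum_flux \<rho> \<mu> v q x c \<bullet> a"
proof -
  let ?D = "frechet_derivative v (at x)"
  have lin: "linear ?D" by (rule linear_frechet_derivative[OF assms])
  have "viscous_traction \<mu> v x a \<bullet> c = viscous_traction \<mu> v x c \<bullet> a"
    by (simp add: viscous_traction_def inner_add_left adjoint_clauses[OF lin])
       (simp add: inner_commute add.commute)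
  then show ?thesis
    by (simp add: momentum_flux_def inner_add_left inner_diff_left) (simp add: inner_commute)
qed

lemma divergence_eq:
  "(G has_derivative G') (at x) \<Longrightarrow> divergence G x = (\<Sum>b\<in>Basis. G' b \<bullet> b)"
  by (simp add: divergence_def frechet_derivative_at[symmetric])

text \<open>For an infinitesimal rigid motion \<open>\<kappa>\<close>, whose gradient \<open>A\<close> is
  antisymmetric, the symmetry of the stress makes every term containing \<open>A\<close> vanish.\<close>

lemma divergence_momentum_flux:
  fixes v :: "'a::euclidean_space \<Rightarrow> 'a" and A :: "'a \<Rightarrow> 'a"
  assumes S: "open S" "x \<in> S"
    and v: "\<And>y. y \<in> S \<Longrightarrow> v differentiable (at y)" "\<And>y. y \<in> S \<Longrightarrow> divergence v y = 0"
    and q: "q differentiable (at x)"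
    and v2: "\<And>b. b \<in> Basis \<Longrightarrow> (\<lambda>y. frechet_derivative v (at y) b) differentiable (at x)"
    and A: "linear A" "\<And>a b. A a \<bullet> b = - (A b \<bullet> a)"
  shows "divergence (\<lambda>y. momentum_flux \<rho> \<mu> v q y (a + A y)) x =
    (a + A x) \<bullet> (- gradient q x - \<rho> *\<^sub>R convection v x + \<mu> *\<^sub>R laplacian v x)"
proof -
  define D where "D y = frechet_derivative v (at y)" for y
  define E where "E b = frechet_derivative (\<lambda>y. D y b) (at x)" for b
  define q' where "q' = frechet_derivative q (at x)"
  define k where "k = a + A x"
  have D: "(v has_derivative D y) (at y)" if "y \<in> S" for y
    using v(1)[OF that] unfolding D_def by (simp add: frechet_derivative_works)
  have E: "((\<lambda>y. D y b) has_derivative E b) (at x)" if "b \<in> Basis" for b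
    using v2[OF that] unfolding D_def E_def by (simp add: frechet_derivative_works)
  have q': "(q has_derivative q') (at x)"
    using q by (simp add: q'_def frechet_derivative_works)
  have blA: "bounded_linear A" using A(1) by (simp add: linear_conv_bounded_linear)
  have k': "((\<lambda>y. a + A y) has_derivative A) (at x)"
    by (auto intro!: derivative_eq_intros bounded_linear.has_derivative[OF blA])
  define kf where "kf y = a + A y" for y
  have kf: "(kf has_derivative A) (at x)" unfolding kf_def[abs_def] by (rule k')
  let ?H = "\<lambda>y. - (q y *\<^sub>R kf y) - (\<rho> * (kf y \<bullet> v y)) *\<^sub>R v y +
    \<mu> *\<^sub>R ((\<Sum>b\<in>Basis. (kf y \<bullet> b) *\<^sub>R D y b) + (\<Sum>b\<in>Basis. (kf y \<bullet> D y b) *\<^sub>R b))"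
  \<comment> \<open>Product rule for \<open>?H\<close> at \<open>x\<close>, with \<open>k\<close>
    the value of \<open>kf\<close> there; the terms in \<open>A c\<close> come from differentiating
    the rigid motion.\<close>
  define H' where "H' c = - (q' c *\<^sub>R k + q x *\<^sub>R A c)
     - ((\<rho> * (A c \<bullet> v x + k \<bullet> D x c)) *\<^sub>R v x + (\<rho> * (k \<bullet> v x)) *\<^sub>R D x c) +
    \<mu> *\<^sub>R ((\<Sum>b\<in>Basis. (A c \<bullet> b) *\<^sub>R D x b + (k \<bullet> b) *\<^sub>R E b c)
      + (\<Sum>b\<in>Basis. (A c \<bullet> D x b + k \<bullet> E b c) *\<^sub>R b))" for c
  have "(?H has_derivative H') (at x)"
    by (rule has_derivative_eq_rhs,
        (rule has_derivative_add has_derivative_diff has_derivative_minus has_derivative_scaleR_right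
          has_derivative_sum has_derivative_scaleR has_derivative_mult_right has_derivative_inner
          has_derivative_inner_left has_derivative_scaleR_left
          q' kf E D[OF S(2)] | assumption)+)
       (simp add: H'_def fun_eq_iff k_def kf_def algebra_simps sum.distrib)
  then have "((\<lambda>y. momentum_flux \<rho> \<mu> v q y (a + A y)) has_derivative H') (at x)"
    by (rule has_derivative_transform_within_open[OF _ S])
      (simp add: momentum_flux_def viscous_traction_eq[OF v(1)] D_def kf_def)
  then have div: "divergence (\<lambda>y. momentum_flux \<rho> \<mu> v q y (a + A y)) x = (\<Sum>c\<in>Basis. H' c \<bullet> c)"
    by (rule divergence_eq)
  have lin: "linear (D x)" using D[OF S(2)] has_derivative_linear by blast
  have expand: "L w = (\<Sum>c\<in>Basis. (w \<bullet> c) *\<^sub>R L c)" if "linear L" for L :: "'a \<Rightarrow> 'a" and w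
    using linear_sum[OF that, of "\<lambda>c. (w \<bullet> c) *\<^sub>R c" Basis]
    by (simp add: linear_cmul[OF that] euclidean_representation)
  have A0: "A w \<bullet> w = 0" for w using A(2)[of w w] by simp
  have s1: "(\<Sum>c\<in>Basis. q' c * (k \<bullet> c)) = k \<bullet> gradient q x"
    by (simp add: gradient_def q'_def inner_sum_right)
  \<comment> \<open>The rigid motion pairs with the convective part of the stress through
    \<open>A (v x) \<bullet> v x\<close>, which is 0 by antisymmetry.\<close>
  have s2: "(\<Sum>c\<in>Basis. (A c \<bullet> v x) * (v x \<bullet> c)) = 0"
  proof -
    have "A (v x) \<bullet> v x = (\<Sum>c\<in>Basis. (A c \<bullet> v x) * (v x \<bullet> c))"
      by (subst expand[OF A(1), of "v x"]) (simp add: inner_sum_left mult.commute)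
    then show ?thesis using A0 by simp
  qed
  have s3: "(\<Sum>c\<in>Basis. (k \<bullet> D x c) * (v x \<bullet> c)) = k \<bullet> convection v x"
    unfolding convection_def D_def[symmetric]
    by (subst expand[OF lin, of "v x"]) (simp add: inner_sum_right mult.commute)
  have s4: "(\<Sum>c\<in>Basis. D x c \<bullet> c) = 0"
    using v(2)[OF S(2)] by (simp add: divergence_def D_def)
  \<comment> \<open>Transposing the velocity gradient and using antisymmetry of \<open>A\<close>
    flips the sign, so the two halves of the viscous stress cancel against each other when paired
    with \<open>A\<close>.\<close>
  have s5: "(\<Sum>c\<in>Basis. A c \<bullet> D x c) = - (\<Sum>c\<in>Basis. \<Sum>b\<in>Basis. (A c \<bullet> b) * (D x b \<bullet> c))"
  proof -
    have "(\<Sum>c\<in>Basis. \<Sum>b\<in>Basis. (A c \<bullet> b) * (D x b \<bullet> c))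
        = (\<Sum>c\<in>Basis. \<Sum>b\<in>Basis. (A b \<bullet> c) * (D x c \<bullet> b))"
      by (rule sum.swap)
    also have "\<dots> = (\<Sum>c\<in>Basis. - (A c \<bullet> D x c))"
    proof (rule sum.cong)
      fix c :: 'a
      have "(\<Sum>b\<in>Basis. (A b \<bullet> c) * (D x c \<bullet> b)) = (\<Sum>b\<in>Basis. - ((A c \<bullet> b) * (D x c \<bullet> b)))"
        by (simp add: A(2)[of _ c])
      then show "(\<Sum>b\<in>Basis. (A b \<bullet> c) * (D x c \<bullet> b)) = - (A c \<bullet> D x c)"
        by (simp add: sum_negf euclidean_inner[of "A c" "D x c"])
    qed simp
    finally show ?thesis by (simp add: sum_negf)
  qed
  \<comment> \<open>The divergence of the transposed velocity gradient is the gradient of the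
    divergence. After exchanging the order of the second derivatives, it vanishes because the
    velocity is divergence free on the whole neighbourhood \<open>S\<close>, not just at
    \<open>x\<close>.\<close>
  have s6: "(\<Sum>c\<in>Basis. E b c \<bullet> c) = 0" if b: "b \<in> Basis" for b
  proof -
    have sym: "E b c \<bullet> c = E c b \<bullet> c" if c: "c \<in> Basis" for c
    proof (rule second_derivative_symmetric[OF S, where B = "\<lambda>h. E b h \<bullet> c" and C = "\<lambda>h. E c h \<bullet> c"])
      show "((\<lambda>z. v z \<bullet> c) has_derivative (\<lambda>h. D y h \<bullet> c)) (at y)" if "y \<in> S" for y
        using D[OF that] by (rule has_derivative_inner_left)
    qed (auto intro!: has_derivative_inner_left E b c)
    have "((\<lambda>y. \<Sum>c\<in>Basis. D y c \<bullet> c) has_derivative (\<lambda>h. \<Sum>c\<in>Basis. E c h \<bullet> c)) (at x)"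
      by (intro has_derivative_sum has_derivative_inner_left E)
    moreover have "((\<lambda>y. \<Sum>c\<in>Basis. D y c \<bullet> c) has_derivative (\<lambda>h. 0)) (at x)"
      by (rule has_derivative_transform_within_open[OF has_derivative_const S, of 0])
        (use v(2) in \<open>simp add: divergence_def D_def\<close>)
    ultimately have "(\<lambda>h. \<Sum>c\<in>Basis. E c h \<bullet> c) = (\<lambda>h. 0)" by (rule has_derivative_unique)
    then show ?thesis using sym by (simp add: fun_eq_iff)
  qed
  have s7: "(\<Sum>c\<in>Basis. \<Sum>b\<in>Basis. (k \<bullet> b) * (E b c \<bullet> c)) = 0"
    by (subst sum.swap) (simp add: sum_distrib_left[symmetric] s6)
  have s8: "(\<Sum>c\<in>Basis. k \<bullet> E c c) = k \<bullet> laplacian v x"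
    by (simp add: laplacian_def E_def D_def inner_sum_right)
  have diag: "(\<Sum>b\<in>Basis. g b *\<^sub>R b) \<bullet> c = g c" if "c \<in> Basis" for g and c :: 'a
    using that by simp
  have "H' c \<bullet> c = - (q' c * (k \<bullet> c)) - \<rho> * ((A c \<bullet> v x) * (v x \<bullet> c)) - \<rho> * ((k \<bullet> D x c) * (v x \<bullet> c))
      - (\<rho> * (k \<bullet> v x)) * (D x c \<bullet> c)
      + \<mu> * (\<Sum>b\<in>Basis. (A c \<bullet> b) * (D x b \<bullet> c)) + \<mu> * (\<Sum>b\<in>Basis. (k \<bullet> b) * (E b c \<bullet> c))
      + \<mu> * (A c \<bullet> D x c) + \<mu> * (k \<bullet> E c c)" if c: "c \<in> Basis" for c
    \<comment> \<open>Here \<open>A0\<close> removes the pressure term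
      \<open>q x * (A c \<bullet> c)\<close>.\<close>
    unfolding H'_def
    by (simp only: inner_add_left inner_diff_left inner_minus_left inner_scaleR_left diag[OF c] A0)
       (simp add: inner_add_left inner_sum_left sum.distrib algebra_simps)
  then have "(\<Sum>c\<in>Basis. H' c \<bullet> c) = - (k \<bullet> gradient q x) - \<rho> * (k \<bullet> convection v x)
      + \<mu> * (k \<bullet> laplacian v x)"
    by (simp add: sum.distrib sum_subtractf sum_negf sum_distrib_left[symmetric] s1 s2 s3 s4 s5 s7 s8)
  then show ?thesis
    unfolding div by (simp add: k_def[symmetric] inner_add_right inner_diff_right)
qed

subsection \<open>Lipschitz fields\<close>

lemma lipschitz_field_bounded_image:
  fixes g :: "'a::euclidean_space \<Rightarrow> 'b::euclidean_space"
  assumes "bounded S" "lipschitz_field S g" shows "bounded (g ` S)"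
  using assms unfolding lipschitz_field_def
  by (auto intro!: bounded_uniformly_continuous_image lipschitz_on_uniformly_continuous)

text \<open>Lipschitz fields are bounded on a bounded set, so the difference of two products splits
  in the usual way into two Lipschitz terms. Stated for a general bilinear map to cover scalar
  multiples and inner products at once.\<close>

lemma lipschitz_field_bilinear:
  fixes g :: "'a::euclidean_space \<Rightarrow> 'b::euclidean_space" and h :: "'a \<Rightarrow> 'c::euclidean_space"
    and bil :: "'b \<Rightarrow> 'c \<Rightarrow> 'd::real_normed_vector"
  assumes "bounded_bilinear bil" "bounded S" "lipschitz_field S g" "lipschitz_field S h"
  shows "lipschitz_field S (\<lambda>x. bil (g x) (h x))"
proof -
  interpret bounded_bilinear bil by fact
  obtain K where K: "0 \<le> K" "\<And>a b. norm (bil a b) \<le> norm a * norm b * K"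
    using nonneg_bounded by blast
  obtain L M where L: "L-lipschitz_on S g" and M: "M-lipschitz_on S h"
    using assms by (auto simp: lipschitz_field_def)
  have L0: "0 \<le> L" "0 \<le> M" using L M by (auto dest: lipschitz_on_nonneg)
  obtain P Q where P: "0 < P" "\<And>x. x \<in> S \<Longrightarrow> norm (g x) \<le> P"
    and Q: "0 < Q" "\<And>x. x \<in> S \<Longrightarrow> norm (h x) \<le> Q"
    using lipschitz_field_bounded_image[OF assms(2,3)] lipschitz_field_bounded_image[OF assms(2,4)]
    unfolding bounded_pos by auto
  have "(K * (L * Q + P * M))-lipschitz_on S (\<lambda>x. bil (g x) (h x))"
  proof (rule lipschitz_onI)
    fix x y assume xy: "x \<in> S" "y \<in> S"
    have "norm (bil (g x) (h x) - bil (g y) (h y)) = norm (bil (g x - g y) (h x) + bil (g y) (h x - h y))"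
      by (simp add: diff_left diff_right)
    also have "\<dots> \<le> norm (g x - g y) * norm (h x) * K + norm (g y) * norm (h x - h y) * K"
      by (intro norm_triangle_mono K)
    also have "\<dots> \<le> (L * dist x y) * Q * K + P * (M * dist x y) * K"
      using lipschitz_onD[OF L xy] lipschitz_onD[OF M xy] xy P Q K L0
      by (intro add_mono mult_mono) (auto simp: dist_norm)
    finally show "dist (bil (g x) (h x)) (bil (g y) (h y)) \<le> K * (L * Q + P * M) * dist x y"
      by (simp add: dist_norm algebra_simps)
  qed (use K L0 P Q in auto)
  then show ?thesis by (auto simp: lipschitz_field_def)
qed

lemma lipschitz_field_add:
  fixes g h :: "'a::metric_space \<Rightarrow> 'b::real_normed_vector"
  shows "lipschitz_field S g \<Longrightarrow> lipschitz_field S h \<Longrightarrow> lipschitz_field S (\<lambda>x. g x + h x)"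
  unfolding lipschitz_field_def by (blast intro: lipschitz_on_add)

lemma lipschitz_field_const: "lipschitz_field S (\<lambda>x. c)"
  unfolding lipschitz_field_def by (blast intro: lipschitz_on_constant)

lemma lipschitz_field_sum:
  fixes g :: "'i \<Rightarrow> 'a::metric_space \<Rightarrow> 'b::real_normed_vector"
  assumes "\<And>i. i \<in> I \<Longrightarrow> lipschitz_field S (g i)"
  shows "lipschitz_field S (\<lambda>x. \<Sum>i\<in>I. g i x)"
  using assms
  by (induction I rule: infinite_finite_induct) (auto intro!: lipschitz_field_add lipschitz_field_const)

lemma lipschitz_field_bounded_linear:
  assumes "bounded_linear L" shows "lipschitz_field S L"
  unfolding lipschitz_field_def
  using bounded_linear.lipschitz_boundE[OF assms] by metis

text \<open>The flux is a polynomial expression in Lipschitz fields. This makes it an admissible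
  field in \<open>divergence_theorem_region\<close>, although its derivative may jump.\<close>

lemma lipschitz_field_momentum_flux:
  fixes v :: "'a::euclidean_space \<Rightarrow> 'a"
  assumes S: "bounded S" and q: "lipschitz_field S q" and v: "lipschitz_field S v"
    and dv: "\<And>x. x \<in> S \<Longrightarrow> v differentiable (at x)"
    and d2: "\<And>b. b \<in> Basis \<Longrightarrow> lipschitz_field S (\<lambda>x. frechet_derivative v (at x) b)"
    and k: "lipschitz_field S k"
  shows "lipschitz_field S (\<lambda>x. momentum_flux \<rho> \<mu> v q x (k x))"
proof -
  let ?D = "\<lambda>x. frechet_derivative v (at x)"
  note prod = lipschitz_field_bilinear[OF bounded_bilinear_scaleR S]
    and inner = lipschitz_field_bilinear[OF bounded_bilinear_inner S]
  have "lipschitz_field S (\<lambda>x. (-1) *\<^sub>R (q x *\<^sub>R k x) + (-\<rho>) *\<^sub>R ((k x \<bullet> v x) *\<^sub>R v x) + 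
    \<mu> *\<^sub>R ((\<Sum>b\<in>Basis. (k x \<bullet> b) *\<^sub>R ?D x b) + (\<Sum>b\<in>Basis. (k x \<bullet> ?D x b) *\<^sub>R b)))"
    by (intro prod inner lipschitz_field_add lipschitz_field_const lipschitz_field_sum q v d2 k)
  then obtain L where L: "L-lipschitz_on S (\<lambda>x. (-1) *\<^sub>R (q x *\<^sub>R k x) + (-\<rho>) *\<^sub>R ((k x \<bullet> v x) *\<^sub>R v x) + 
    \<mu> *\<^sub>R ((\<Sum>b\<in>Basis. (k x \<bullet> b) *\<^sub>R ?D x b) + (\<Sum>b\<in>Basis. (k x \<bullet> ?D x b) *\<^sub>R b)))"
    unfolding lipschitz_field_def ..
  have "L-lipschitz_on S (\<lambda>x. momentum_flux \<rho> \<mu> v q x (k x))"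
    by (rule lipschitz_on_transform[OF L]) (simp add: momentum_flux_def viscous_traction_eq[OF dv])
  then show ?thesis by (auto simp: lipschitz_field_def)
qed

subsection \<open>Moments of the spread force\<close>

text \<open>Provides the hypothesis of Fubini's theorem for the product of two copies of
  \<open>lebesgue\<close>; the countable cover is inherited from \<open>lborel\<close>.\<close>

lemma sigma_finite_lebesgue: "sigma_finite_measure (lebesgue :: 'a::euclidean_space measure)"
proof -
  obtain A :: "'a set set" where "countable A" "A \<subseteq> sets lborel" "\<Union>A = space lborel"
    "\<forall>a\<in>A. emeasure lborel a \<noteq> \<infinity>"
    using lborel.sigma_finite_countable by blast
  then show ?thesis
    by (intro sigma_finite_measure.intro exI[of _ A]) (auto simp: emeasure_completion)
qed

lemma
  fixes h :: "'a::euclidean_space \<Rightarrow> 'b::{banach, second_countable_topology}"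
  assumes [measurable]: "h \<in> borel_measurable borel"
  shows integrable_lborel_shift: "integrable lborel (\<lambda>x. h (x - y)) \<longleftrightarrow> integrable lborel h"
    and integral_lborel_shift: "(LINT x|lborel. h (x - y)) = (LINT x|lborel. h x)"
proof -
  have eq: "(\<lambda>x. h (x - y)) = (\<lambda>x. h ((-y) + x))" by (auto simp: fun_eq_iff)
  show "integrable lborel (\<lambda>x. h (x - y)) \<longleftrightarrow> integrable lborel h"
    unfolding eq by (subst (2) lborel_distr_plus[symmetric, of "-y"], subst integrable_distr_eq) auto
  show "(LINT x|lborel. h (x - y)) = (LINT x|lborel. h x)"
    unfolding eq by (subst (2) lborel_distr_plus[symmetric, of "-y"], subst integral_distr) auto
qed

lemma integral_lborel_reflect:
  fixes h :: "'a::euclidean_space \<Rightarrow> 'b::{banach, second_countable_topology}"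
  assumes [measurable]: "h \<in> borel_measurable borel"
  shows "(LINT x|lborel. h (- x)) = (LINT x|lborel. h x)"
proof -
  have "(lborel :: 'a measure) = distr lborel borel (\<lambda>x. - x)"
    using lborel_affine[of "-1" "0 :: 'a"] by (simp add: density_1)
  then have "(LINT x|lborel. h x) = (LINT x|distr lborel borel (\<lambda>x. - x). h x)" by simp
  also have "\<dots> = (LINT x|lborel. h (- x))" by (subst integral_distr) auto
  finally show ?thesis by simp
qed

lemma linear_bounded_on:
  fixes l :: "'a::euclidean_space \<Rightarrow> real"
  assumes "linear l" "bounded S"
  obtains N where "0 \<le> N" "\<And>x. x \<in> S \<Longrightarrow> \<bar>c + l x\<bar> \<le> N"
proof -
  have "bounded ((\<lambda>x. c + l x) ` S)"
    using bounded_translation[of "l ` S" c] bounded_linear_image[OF assms(2), of l] assms(1)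
    by (simp add: linear_conv_bounded_linear image_image)
  then show ?thesis using that unfolding bounded_pos by (auto intro: less_imp_le)
qed

text \<open>An even kernel of mass one reproduces affine functions. Since the kernel is nonnegative, the
  mass condition on \<open>\<Omega>\<close> forces it to vanish almost everywhere outside \<open>\<Omega>\<close>.\<close>

lemma kernel_reproduces_affine:
  fixes k :: "'a::euclidean_space \<Rightarrow> real"
  assumes k: "admissible_delta (Regularized k)" and \<Omega>: "open \<Omega>"
    and mass: "(LINT x:\<Omega>|lebesgue. k (x - y)) = 1" and l: "linear l"
  shows "set_integrable lebesgue \<Omega> (\<lambda>x. k (x - y) * (c + l x))"
    and "(LINT x:\<Omega>|lebesgue. k (x - y) * (c + l x)) = c + l y"
proof -
  have cont: "continuous_on UNIV k" and nn: "\<And>z. 0 \<le> k z" and even: "\<And>z. k (- z) = k z"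
    and supp: "bounded {z. k z \<noteq> 0}" and one: "(LINT z|lebesgue. k z) = 1"
    using k by auto
  have km[measurable]: "k \<in> borel_measurable borel" by (rule borel_measurable_continuous_onI[OF cont])
  have [measurable]: "\<Omega> \<in> sets borel" using \<Omega> by auto
  have lm[measurable]: "l \<in> borel_measurable borel"
    using l by (intro borel_measurable_continuous_onI linear_continuous_on) (simp add: linear_conv_bounded_linear)
  have one': "(LINT z|lborel. k z) = 1" using one by (simp add: integral_completion)
  \<comment> \<open>A non-integrable function has Bochner integral 0 by convention, so mass one
    already entails integrability.\<close>
  then have ik: "integrable lborel k" using not_integrable_integral_eq by fastforce
  obtain N where N: "0 \<le> N" "\<And>z. z \<in> {z. k z \<noteq> 0} \<Longrightarrow> \<bar>0 + l z\<bar> \<le> N"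
    using linear_bounded_on[OF l supp, where c = 0] by blast
  have ikl: "integrable lborel (\<lambda>z. k z * l z)"
  proof (rule Bochner_Integration.integrable_bound)
    show "integrable lborel (\<lambda>z. N * k z)" using ik by simp
    show "AE z in lborel. norm (k z * l z) \<le> norm (N * k z)"
    proof (rule AE_I2)
      fix z show "norm (k z * l z) \<le> norm (N * k z)"
        using N(1) N(2)[of z] nn[of z]
        by (cases "k z = 0") (auto simp: abs_mult mult.commute intro: mult_right_mono)
    qed
  qed simp
  \<comment> \<open>The first moment of an even kernel equals its own negative under
    reflection.\<close>
  have "(LINT z|lborel. k z * l z) = (LINT z|lborel. k (- z) * l (- z))"
    by (rule integral_lborel_reflect[symmetric]) simp
  also have "\<dots> = - (LINT z|lborel. k z * l z)" by (simp add: even linear_neg[OF l])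
  finally have odd: "(LINT z|lborel. k z * l z) = 0" by simp
  \<comment> \<open>The integrand with the kernel moved to the origin; it splits into a multiple of
    the mass and the vanishing first moment.\<close>
  let ?h = "\<lambda>z. k z * (c + l (z + y))"
  have h: "?h z = (c + l y) * k z + k z * l z" for z
    by (simp add: linear_add[OF l] algebra_simps)
  have "integrable lborel ?h" "(LINT z|lborel. ?h z) = c + l y"
    unfolding h using ik ikl by (simp_all add: odd one')
  moreover have [measurable]: "?h \<in> borel_measurable borel" by measurable
  ultimately have full: "integrable lborel (\<lambda>x. k (x - y) * (c + l x))"
    "(LINT x|lborel. k (x - y) * (c + l x)) = c + l y"
    using integrable_lborel_shift[of ?h y] integral_lborel_shift[of ?h y] by auto
  have iks: "integrable lborel (\<lambda>x. k (x - y))" "(LINT x|lborel. k (x - y)) = 1"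
    using integrable_lborel_shift[of k y] integral_lborel_shift[of k y] ik one' by auto
  have ind: "integrable lborel (\<lambda>x. indicator \<Omega> x * k (x - y))"
    using integrable_mult_indicator[OF _ iks(1), of \<Omega>] by simp
  have mass': "(LINT x|lborel. indicator \<Omega> x * k (x - y)) = 1"
    using mass unfolding set_lebesgue_integral_def by (simp add: integral_completion)
  have "(LINT x|lborel. k (x - y) - indicator \<Omega> x * k (x - y)) = 0"
    using iks ind mass' by simp
  then have "AE x in lborel. k (x - y) - indicator \<Omega> x * k (x - y) = 0"
    using iks(1) ind nn
    by (subst (asm) integral_nonneg_eq_0_iff_AE) (auto split: split_indicator)
  then have ae: "AE x in lborel. indicator \<Omega> x * (k (x - y) * (c + l x)) = k (x - y) * (c + l x)"
    by eventually_elim (auto split: split_indicator)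
  have "integrable lborel (\<lambda>x. indicator \<Omega> x * (k (x - y) * (c + l x)))"
    using integrable_mult_indicator[OF _ full(1), of \<Omega>] by simp
  then show "set_integrable lebesgue \<Omega> (\<lambda>x. k (x - y) * (c + l x))"
    unfolding set_integrable_def by (simp add: integrable_completion)
  have "(LINT x|lborel. indicator \<Omega> x * (k (x - y) * (c + l x))) = c + l y"
    using ae full(2) by (subst integral_cong_AE[OF _ _ ae]) auto
  then show "(LINT x:\<Omega>|lebesgue. k (x - y) * (c + l x)) = c + l y"
    unfolding set_lebesgue_integral_def by (simp add: integral_completion)
qed

lemma set_integrable_bounded_scaleR:
  fixes g :: "'a::euclidean_space \<Rightarrow> real" and h :: "'a \<Rightarrow> 'b::euclidean_space"
  assumes "g \<in> borel_measurable (lebesgue_on S)" "S \<in> sets lebesgue" "bounded (g ` S)"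
    "set_integrable lebesgue S h"
  shows "set_integrable lebesgue S (\<lambda>x. g x *\<^sub>R h x)"
proof -
  have "bilinear (scaleR :: real \<Rightarrow> 'b \<Rightarrow> 'b)"
    using bounded_bilinear_scaleR bilinear_conv_bounded_bilinear by blast
  from absolutely_integrable_bounded_measurable_product[OF this assms] show ?thesis .
qed

text \<open>For the Dirac delta function, test the distributional identity with the affine function
  cut off away from \<open>C\<close>. For a regularized one, exchange the two integrals and use that
  the kernel reproduces affine functions.\<close>

lemma spread_force_affine_moment:
  fixes F Y f :: "'a::euclidean_space \<Rightarrow> 'a" and l :: "'a \<Rightarrow> real"
  assumes \<delta>: "admissible_delta \<delta>" and \<Omega>: "open \<Omega>" and U: "U \<in> sets lebesgue"
    and Y: "continuous_on U Y" and F: "set_integrable lebesgue U F"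
    and mass: "\<And>s. s \<in> U \<Longrightarrow> delta_integral \<delta> \<Omega> (Y s) (\<lambda>x. 1 :: real) = 1"
    and f: "spread_force \<delta> \<Omega> U F Y f"
    and C: "bounded C" "Y ` U \<subseteq> C" "\<And>x. x \<in> \<Omega> \<Longrightarrow> x \<notin> C \<Longrightarrow> f x = 0"
    and l: "linear l"
  shows "set_integrable lebesgue \<Omega> (\<lambda>x. (c + l x) *\<^sub>R f x) \<and>
    (LINT x:\<Omega>|lebesgue. (c + l x) *\<^sub>R f x) = (LINT s:U|lebesgue. (c + l (Y s)) *\<^sub>R F s)"
proof (cases \<delta>)
  case Dirac
  have fi: "set_integrable lebesgue \<Omega> f" and test: "\<And>\<phi> :: 'a \<Rightarrow> real.
      continuous_on UNIV \<phi> \<Longrightarrow> bounded {x. \<phi> x \<noteq> 0} \<Longrightarrow>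
      (LINT x:\<Omega>|lebesgue. \<phi> x *\<^sub>R f x) = (LINT s:U|lebesgue. \<phi> (Y s) *\<^sub>R F s)"
    using f Dirac by auto
  obtain R where R: "\<And>x. x \<in> C \<Longrightarrow> norm x \<le> R" using C(1) by (auto simp: bounded_iff)
  \<comment> \<open>The cutoff is 1 on the ball of radius \<open>R\<close>, which contains
    \<open>C\<close>, and 0 outside radius \<open>R + 1\<close>. So \<open>\<phi>\<close> is an
    admissible test function that agrees with the affine one wherever \<open>f\<close> or the
    material points are relevant.\<close>
  define \<phi> where "\<phi> x = max 0 (min 1 (R + 1 - norm x)) * (c + l x)" for x
  have contl: "continuous_on UNIV l" using l by (intro linear_continuous_on) (simp add: linear_conv_bounded_linear)
  have cont: "continuous_on UNIV \<phi>" unfolding \<phi>_def by (intro continuous_intros contl)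
  have "{x. \<phi> x \<noteq> 0} \<subseteq> cball 0 (R + 1)" by (auto simp: \<phi>_def max_def)
  then have supp: "bounded {x. \<phi> x \<noteq> 0}" by (rule bounded_subset[rotated]) simp
  have on_C: "\<phi> x = c + l x" if "x \<in> C" for x using R[OF that] by (simp add: \<phi>_def)
  have f_eq: "\<phi> x *\<^sub>R f x = (c + l x) *\<^sub>R f x" if "x \<in> \<Omega>" for x
    using on_C[of x] C(3)[OF that] by (cases "x \<in> C") auto
  have F_eq: "\<phi> (Y s) *\<^sub>R F s = (c + l (Y s)) *\<^sub>R F s" if "s \<in> U" for s
    using on_C C(2) that by auto
  obtain N where N: "0 \<le> N" "\<And>x. x \<in> {x. \<phi> x \<noteq> 0} \<Longrightarrow> \<bar>c + l x\<bar> \<le> N"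
    using linear_bounded_on[OF l supp, where c = c] by blast
  have "set_integrable lebesgue \<Omega> (\<lambda>x. \<phi> x *\<^sub>R f x)"
  proof (rule set_integrable_bounded_scaleR[OF _ _ _ fi])
    show "\<phi> \<in> borel_measurable (lebesgue_on \<Omega>)"
      by (rule continuous_imp_measurable_on_sets_lebesgue[OF continuous_on_subset[OF cont]]) (use \<Omega> in auto)
    have "\<bar>\<phi> x\<bar> \<le> N" for x
    proof (cases "\<phi> x = 0")
      case False
      have "\<bar>\<phi> x\<bar> = \<bar>max 0 (min 1 (R + 1 - norm x))\<bar> * \<bar>c + l x\<bar>"
        unfolding \<phi>_def by (rule abs_mult)
      also have "\<dots> \<le> 1 * N"
        by (rule mult_mono[OF _ N(2)]) (use False in auto)
      finally show ?thesis by simp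
    qed (use N(1) in simp)
    then show "bounded (\<phi> ` \<Omega>)" by (auto simp: bounded_iff)
  qed (use \<Omega> in auto)
  then have "set_integrable lebesgue \<Omega> (\<lambda>x. (c + l x) *\<^sub>R f x)"
    by (subst set_integrable_cong[OF refl refl f_eq[symmetric]])
  moreover have "(LINT x:\<Omega>|lebesgue. (c + l x) *\<^sub>R f x) = (LINT x:\<Omega>|lebesgue. \<phi> x *\<^sub>R f x)"
    by (rule set_lebesgue_integral_cong) (use \<Omega> in \<open>auto simp: f_eq\<close>)
  moreover have "(LINT s:U|lebesgue. (c + l (Y s)) *\<^sub>R F s) = (LINT s:U|lebesgue. \<phi> (Y s) *\<^sub>R F s)"
    by (rule set_lebesgue_integral_cong) (use U in \<open>auto simp: F_eq\<close>)
  ultimately show ?thesis using test[OF cont supp] by simp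
next
  case (Regularized k)
  have adm: "admissible_delta (Regularized k)" using \<delta> Regularized by simp
  have contk: "continuous_on UNIV k" and suppk: "bounded {z. k z \<noteq> 0}" using adm by auto
  have f_eq: "\<And>x. x \<in> \<Omega> \<Longrightarrow> f x = (LINT s:U|lebesgue. k (x - Y s) *\<^sub>R F s)"
    using f Regularized by auto
  \<comment> \<open>\<open>Y\<close> is known to be measurable only on \<open>U\<close>; the
    extension by 0 is measurable everywhere, and the indicator in \<open>F'\<close> hides the values
    outside \<open>U\<close>.\<close>
  define Y' where "Y' s = (if s \<in> U then Y s else 0)" for s
  define F' where "F' s = indicator U s *\<^sub>R F s" for s
  define g where "g x s = (indicator \<Omega> x * (k (x - Y' s) * (c + l x))) *\<^sub>R F' s" for x s
  have iF': "integrable lebesgue F'" using F unfolding set_integrable_def F'_def .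
  note [measurable] = borel_measurable_integrable[OF iF']
  have [measurable]: "Y' \<in> borel_measurable lebesgue"
    unfolding Y'_def[abs_def]
    by (rule borel_measurable_if_I[OF continuous_imp_measurable_on_sets_lebesgue[OF Y U] U])
  have [measurable]: "k \<in> borel_measurable borel" by (rule borel_measurable_continuous_onI[OF contk])
  have [measurable]: "l \<in> borel_measurable borel"
    using l by (intro borel_measurable_continuous_onI linear_continuous_on) (simp add: linear_conv_bounded_linear)
  have [measurable]: "\<Omega> \<in> sets borel" using \<Omega> by auto
  have [measurable]: "(\<lambda>x :: 'a. x) \<in> borel_measurable lebesgue" by (rule measurable_completion) simp
  have [measurable]: "fst \<in> borel_measurable ((lebesgue :: 'a measure) \<Otimes>\<^sub>M (lebesgue :: 'a measure))"
    using measurable_compose[OF measurable_fst \<open>(\<lambda>x :: 'a. x) \<in> borel_measurable lebesgue\<close>] .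
  have [measurable]: "(\<lambda>p. F' (snd p)) \<in> borel_measurable ((lebesgue :: 'a measure) \<Otimes>\<^sub>M (lebesgue :: 'a measure))"
    by (rule measurable_compose[OF measurable_snd]) (rule borel_measurable_integrable[OF iF'])
  have [measurable]: "(\<lambda>p. Y' (snd p)) \<in> borel_measurable ((lebesgue :: 'a measure) \<Otimes>\<^sub>M (lebesgue :: 'a measure))"
    by (rule measurable_compose[OF measurable_snd]) measurable
  have "bounded (k ` closure {z. k z \<noteq> 0})"
    by (intro compact_imp_bounded compact_continuous_image continuous_on_subset[OF contk])
      (use suppk in auto)
  then obtain M where M: "0 < M" "\<And>z. z \<in> closure {z. k z \<noteq> 0} \<Longrightarrow> \<bar>k z\<bar> \<le> M"
    unfolding bounded_pos by auto
  have kM: "\<bar>k z\<bar> \<le> M" for z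
    using M(1) M(2)[of z] closure_subset[of "{z. k z \<noteq> 0}"] by (cases "k z = 0") auto
  obtain r where r: "\<And>z. k z \<noteq> 0 \<Longrightarrow> norm z \<le> r" using suppk by (auto simp: bounded_iff)
  obtain R where R: "\<And>s. s \<in> U \<Longrightarrow> norm (Y s) \<le> R" using C(1,2) by (auto simp: bounded_iff)
  \<comment> \<open>Kernels centred at material points all live in one ball, so a multiple of its
    indicator times \<open>F'\<close> dominates the joint integrand \<open>g\<close> and Fubini's
    theorem applies.\<close>
  have near: "norm x \<le> r + R" if "k (x - Y s) \<noteq> 0" "s \<in> U" for x s
    using r[OF that(1)] R[OF that(2)] norm_triangle_sub[of x "Y s"] by linarith
  obtain N where N: "0 \<le> N" "\<And>x. x \<in> cball 0 (r + R) \<Longrightarrow> \<bar>c + l x\<bar> \<le> N"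
    using linear_bounded_on[OF l bounded_cball, where c = c] by blast
  interpret L: sigma_finite_measure "lebesgue :: 'a measure" by (rule sigma_finite_lebesgue)
  interpret P: pair_sigma_finite "lebesgue :: 'a measure" "lebesgue :: 'a measure" ..
  define B where "B = cball (0 :: 'a) (r + R)"
  have [measurable]: "(\<lambda>p. indicator B (fst p) :: real) \<in> borel_measurable ((lebesgue :: 'a measure) \<Otimes>\<^sub>M (lebesgue :: 'a measure))"
    unfolding B_def
    by (rule measurable_compose[OF \<open>fst \<in> borel_measurable (lebesgue \<Otimes>\<^sub>M lebesgue)\<close>]) (intro borel_measurable_indicator, simp)
  have [measurable]: "(\<lambda>p. indicator \<Omega> (fst p) :: real) \<in> borel_measurable ((lebesgue :: 'a measure) \<Otimes>\<^sub>M (lebesgue :: 'a measure))"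
    by (rule measurable_compose[OF \<open>fst \<in> borel_measurable (lebesgue \<Otimes>\<^sub>M lebesgue)\<close>]) (intro borel_measurable_indicator, simp)
  have iB: "integrable lebesgue (indicator B :: 'a \<Rightarrow> real)"
    unfolding B_def by (intro integrable_real_indicator) (use emeasure_lborel_cball_finite[of "0 :: 'a" "r + R"] in auto)
  have ig: "integrable (lebesgue \<Otimes>\<^sub>M lebesgue) (case_prod g)"
  proof (rule Bochner_Integration.integrable_bound)
    show "integrable (lebesgue \<Otimes>\<^sub>M lebesgue) (\<lambda>p. (M * N * indicator B (fst p)) *\<^sub>R F' (snd p))"
    proof (rule P.Fubini_integrable)
      show "(\<lambda>p. (M * N * indicator B (fst p)) *\<^sub>R F' (snd p)) \<in> borel_measurable (lebesgue \<Otimes>\<^sub>M lebesgue)"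
        by measurable
      show "integrable lebesgue (\<lambda>x. LINT y|lebesgue. norm ((M * N * indicator B (fst (x, y))) *\<^sub>R F' (snd (x, y))))"
        using iB N M by (simp add: abs_mult)
    qed (use iF' in simp)
    show "case_prod g \<in> borel_measurable (lebesgue \<Otimes>\<^sub>M lebesgue)"
      unfolding g_def split_beta' by measurable
    have "norm (g x s) \<le> norm ((M * N * indicator B x) *\<^sub>R F' s)" for x s
    proof (cases "s \<in> U \<and> k (x - Y s) \<noteq> 0")
      case True
      then have xB: "x \<in> B" using near by (auto simp: B_def)
      have "indicator \<Omega> x * (\<bar>k (x - Y' s)\<bar> * \<bar>c + l x\<bar>) \<le> 1 * (M * N)"
        using kM N xB M(1) unfolding B_def by (intro mult_mono) (auto simp: indicator_def)
      then show ?thesis using xB N M(1)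
        unfolding g_def by (simp add: abs_mult mult_right_mono)
    next
      case False
      then have "g x s = 0" by (auto simp: g_def F'_def Y'_def)
      then show ?thesis by simp
    qed
    then show "AE p in lebesgue \<Otimes>\<^sub>M lebesgue. norm (case_prod g p) \<le> norm ((M * N * indicator B (fst p)) *\<^sub>R F' (snd p))"
      by auto
  qed
  \<comment> \<open>Integrating over the material points first recovers the definition of the spread
    force.\<close>
  have inner_s: "(LINT s|lebesgue. g x s) = indicator \<Omega> x *\<^sub>R ((c + l x) *\<^sub>R f x)" for x
  proof -
    have "g x s = (indicator \<Omega> x * (c + l x)) *\<^sub>R (k (x - Y' s) *\<^sub>R F' s)" for s
      by (simp add: g_def mult_ac)
    then have "(LINT s|lebesgue. g x s) = (indicator \<Omega> x * (c + l x)) *\<^sub>R (LINT s|lebesgue. k (x - Y' s) *\<^sub>R F' s)"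
      by (simp only: integral_scaleR_right)
    also have "(LINT s|lebesgue. k (x - Y' s) *\<^sub>R F' s) = (LINT s:U|lebesgue. k (x - Y s) *\<^sub>R F s)"
      unfolding set_lebesgue_integral_def
      by (intro Bochner_Integration.integral_cong) (auto simp: F'_def Y'_def split: split_indicator)
    finally show ?thesis using f_eq[of x] by (cases "x \<in> \<Omega>") simp_all
  qed
  \<comment> \<open>Integrating over space first leaves the affine function evaluated at
    \<open>Y s\<close>, by the reproducing property.\<close>
  have inner_x: "(LINT x|lebesgue. g x s) = indicator U s *\<^sub>R ((c + l (Y s)) *\<^sub>R F s)" for s
  proof (cases "s \<in> U")
    case True
    note rep = kernel_reproduces_affine[OF adm \<Omega> _ l, of "Y s" c]
    have m: "(LINT x:\<Omega>|lebesgue. k (x - Y s)) = 1" using mass[OF True] Regularized by simp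
    show ?thesis
      using rep[OF m] True
      by (simp add: g_def F'_def Y'_def set_lebesgue_integral_def set_integrable_def)
  qed (simp add: g_def F'_def)
  show ?thesis
    using P.integrable_fst[OF ig] P.Fubini_integral[OF ig]
    unfolding inner_s inner_x set_integrable_def set_lebesgue_integral_def by simp
qed

section \<open>Vector moments from scalar ones, and work in a rigid motion\<close>

lemma set_integrable_componentwise:
  fixes g :: "'a \<Rightarrow> 'b::euclidean_space"
  assumes "\<And>b. b \<in> Basis \<Longrightarrow> set_integrable M S (\<lambda>x. g x \<bullet> b)"
  shows "set_integrable M S g"
proof -
  have "integrable M (\<lambda>x. \<Sum>b\<in>Basis. (indicator S x *\<^sub>R (g x \<bullet> b)) *\<^sub>R b)"
    using assms unfolding set_integrable_def
    by (intro Bochner_Integration.integrable_sum Bochner_Integration.integrable_scaleR_left)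
  also have "(\<lambda>x. \<Sum>b\<in>Basis. (indicator S x *\<^sub>R (g x \<bullet> b)) *\<^sub>R b) = (\<lambda>x. indicator S x *\<^sub>R g x)"
    by (simp add: fun_eq_iff scaleR_sum_right[symmetric] euclidean_representation flip: scaleR_scaleR)
  finally show ?thesis unfolding set_integrable_def .
qed

lemma set_integral_inner_left:
  fixes g :: "'a \<Rightarrow> 'b::euclidean_space"
  assumes "set_integrable M S g"
  shows "(LINT x:S|M. g x \<bullet> b) = (LINT x:S|M. g x) \<bullet> b"
  using integral_inner_left[of b M "\<lambda>x. indicator S x *\<^sub>R g x"] assms
  unfolding set_integrable_def set_lebesgue_integral_def by simp

lemma
  fixes g h :: "'a \<Rightarrow> 'b::euclidean_space"
  assumes "\<And>b. b \<in> Basis \<Longrightarrow> set_integrable M S (\<lambda>x. (g x \<bullet> b) *\<^sub>R h x)"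
  shows set_integrable_inner_componentwise: "set_integrable M S (\<lambda>x. g x \<bullet> h x)"
    and set_integral_inner_componentwise:
      "(LINT x:S|M. g x \<bullet> h x) = (\<Sum>b\<in>Basis. (LINT x:S|M. (g x \<bullet> b) *\<^sub>R h x) \<bullet> b)"
proof -
  have expand: "indicator S x *\<^sub>R (g x \<bullet> h x) = (\<Sum>b\<in>Basis. (indicator S x *\<^sub>R ((g x \<bullet> b) *\<^sub>R h x)) \<bullet> b)" for x
    by (subst euclidean_inner) (simp add: sum_distrib_left mult.assoc)
  have int: "integrable M (\<lambda>x. indicator S x *\<^sub>R ((g x \<bullet> b) *\<^sub>R h x))" if "b \<in> Basis" for b
    using assms[OF that] unfolding set_integrable_def .
  show "set_integrable M S (\<lambda>x. g x \<bullet> h x)"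
    unfolding set_integrable_def expand
    by (intro Bochner_Integration.integrable_sum integrable_inner_left int)
  have "(LINT x|M. (\<Sum>b\<in>Basis. (indicator S x *\<^sub>R ((g x \<bullet> b) *\<^sub>R h x)) \<bullet> b)) =
      (\<Sum>b\<in>Basis. LINT x|M. (indicator S x *\<^sub>R ((g x \<bullet> b) *\<^sub>R h x)) \<bullet> b)"
    by (intro Bochner_Integration.integral_sum integrable_inner_left int)
  also have "\<dots> = (\<Sum>b\<in>Basis. (LINT x|M. indicator S x *\<^sub>R ((g x \<bullet> b) *\<^sub>R h x)) \<bullet> b)"
    by (intro sum.cong refl integral_inner_left int)
  finally show "(LINT x:S|M. g x \<bullet> h x) = (\<Sum>b\<in>Basis. (LINT x:S|M. (g x \<bullet> b) *\<^sub>R h x) \<bullet> b)"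
    unfolding set_lebesgue_integral_def expand .
qed

text \<open>Each component of \<open>a + A x\<close> is a scalar affine function of
  \<open>x\<close>, so the work is a finite sum of components of the affine moments.\<close>

lemma spread_force_rigid_moment:
  fixes F Y f A :: "'a::euclidean_space \<Rightarrow> 'a"
  assumes \<delta>: "admissible_delta \<delta>" and \<Omega>: "open \<Omega>" and U: "U \<in> sets lebesgue"
    and Y: "continuous_on U Y" and F: "set_integrable lebesgue U F"
    and mass: "\<And>s. s \<in> U \<Longrightarrow> delta_integral \<delta> \<Omega> (Y s) (\<lambda>x. 1 :: real) = 1"
    and f: "spread_force \<delta> \<Omega> U F Y f"
    and C: "bounded C" "Y ` U \<subseteq> C" "\<And>x. x \<in> \<Omega> \<Longrightarrow> x \<notin> C \<Longrightarrow> f x = 0"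
    and A: "linear A"
  shows "set_integrable lebesgue U (\<lambda>s. (a + A (Y s)) \<bullet> F s)"
    and "set_integrable lebesgue \<Omega> (\<lambda>x. (a + A x) \<bullet> f x)"
    and "(LINT x:\<Omega>|lebesgue. (a + A x) \<bullet> f x) = (LINT s:U|lebesgue. (a + A (Y s)) \<bullet> F s)"
proof -
  have l: "linear (\<lambda>x. A x \<bullet> b)" for b
    using linear_compose[OF A bounded_linear.linear[OF bounded_linear_inner_left]] by (simp add: o_def)
  note m = spread_force_affine_moment[OF \<delta> \<Omega> U Y F mass f C l]
  have bY: "bounded (Y ` U)" using C bounded_subset by blast
  \<comment> \<open>On the Lagrangian side the affine factor is bounded, as the material points stay
    in the bounded set \<open>C\<close>.\<close>
  have iU: "set_integrable lebesgue U (\<lambda>s. (a \<bullet> b + A (Y s) \<bullet> b) *\<^sub>R F s)" for b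
  proof (rule set_integrable_bounded_scaleR[OF _ U _ F])
    have "continuous_on U (\<lambda>s. A (Y s))"
      using Y A by (intro continuous_on_compose2[OF linear_continuous_on[of A UNIV] Y])
        (auto simp: linear_conv_bounded_linear)
    then show "(\<lambda>s. a \<bullet> b + A (Y s) \<bullet> b) \<in> borel_measurable (lebesgue_on U)"
      by (intro continuous_imp_measurable_on_sets_lebesgue U continuous_intros)
    obtain N where "\<And>x. x \<in> Y ` U \<Longrightarrow> \<bar>a \<bullet> b + A x \<bullet> b\<bar> \<le> N"
      using linear_bounded_on[OF l bY, where c = "a \<bullet> b"] by blast
    then show "bounded ((\<lambda>s. a \<bullet> b + A (Y s) \<bullet> b) ` U)" by (auto simp: bounded_iff)
  qed
  have moments: "set_integrable lebesgue U (\<lambda>s. ((a + A (Y s)) \<bullet> b) *\<^sub>R F s)"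
    "set_integrable lebesgue \<Omega> (\<lambda>x. ((a + A x) \<bullet> b) *\<^sub>R f x)"
    "(LINT x:\<Omega>|lebesgue. ((a + A x) \<bullet> b) *\<^sub>R f x) = (LINT s:U|lebesgue. ((a + A (Y s)) \<bullet> b) *\<^sub>R F s)" for b
    using iU[of b] m[of "a \<bullet> b" b] by (simp_all only: inner_add_left simp_thms)
  show "set_integrable lebesgue U (\<lambda>s. (a + A (Y s)) \<bullet> F s)"
    "set_integrable lebesgue \<Omega> (\<lambda>x. (a + A x) \<bullet> f x)"
    by (intro set_integrable_inner_componentwise moments)+
  show "(LINT x:\<Omega>|lebesgue. (a + A x) \<bullet> f x) = (LINT s:U|lebesgue. (a + A (Y s)) \<bullet> F s)"
    unfolding set_integral_inner_componentwise[OF moments(1)] set_integral_inner_componentwise[OF moments(2)]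
      moments(3) ..
qed

subsection \<open>Force and torque balance\<close>

text \<open>The two descriptions of the body momenta agree only for times in \<open>J\<close>;
  openness of \<open>J\<close> is what carries the equality over to derivatives.\<close>

lemma vector_derivative_cong_open:
  assumes "open J" "t \<in> J" "\<And>\<tau>. \<tau> \<in> J \<Longrightarrow> g \<tau> = h \<tau>"
  shows "vector_derivative g (at t) = vector_derivative h (at t)"
proof (rule vector_derivative_cong_eq)
  show "eventually (\<lambda>\<tau>. \<tau> \<in> UNIV \<longrightarrow> g \<tau> = h \<tau>) (nhds t)"
    using eventually_nhds_in_open[OF assms(1,2)] by eventually_elim (use assms(3) in auto)
qed auto

context immersed_body_cv
begin

text \<open>The integrability claims accompany the work identity because recovering vector
  identities from it requires moving fixed vectors out of the integrals.\<close>

lemma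
  assumes t: "t \<in> J" and A: "linear A" "\<And>a b. A a \<bullet> b = - (A b \<bullet> a)"
  shows force_work_integrable: "set_integrable lebesgue (CV t) (\<lambda>x. (a + A x) \<bullet> f t x)"
    and multiplier_work_integrable: "set_integrable lebesgue U (\<lambda>s. (a + A (X t s)) \<bullet> F t s)"
    and inertia_work_integrable:
      "set_integrable lebesgue (CV t) (\<lambda>x. (a + A x) \<bullet> (\<rho> *\<^sub>R time_deriv u t x))"
    and flux_work_integrable: "set_integrable surface_measure (frontier (CV t))
      (\<lambda>x. (a + A x) \<bullet> momentum_flux \<rho> \<mu> (u t) (p t) x (n t x))"
    and force_work: "(LINT x:CV t|lebesgue. (a + A x) \<bullet> f t x) =
      (LINT s:U|lebesgue. (a + A (X t s)) \<bullet> F t s)"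
    and virtual_work: "(LINT s:U|lebesgue. (a + A (X t s)) \<bullet> F t s) =
      (LINT x:CV t|lebesgue. (a + A x) \<bullet> (\<rho> *\<^sub>R time_deriv u t x)) -
      (LINT x:frontier (CV t)|surface_measure. (a + A x) \<bullet> momentum_flux \<rho> \<mu> (u t) (p t) x (n t x))"
proof -
  define \<kappa> where "\<kappa> x = a + A x" for x
  define H where "H x = momentum_flux \<rho> \<mu> (u t) (p t) x (\<kappa> x)" for x
  have bCV: "bounded (CV t)" and mCV[measurable]: "CV t \<in> sets lebesgue"
    and gauss: "\<And>G. lipschitz_field (closure (CV t)) G \<Longrightarrow>
        set_integrable lebesgue (CV t) (divergence G) \<and>
        set_integrable surface_measure (frontier (CV t)) (\<lambda>x. G x \<bullet> n t x) \<and>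
        (LINT x:CV t|lebesgue. divergence G x) = (LINT x:frontier (CV t)|surface_measure. G x \<bullet> n t x)"
    using region[OF t] by (auto simp: divergence_theorem_region_def)
  have CV: "X t ` U \<subseteq> CV t" "CV t \<subseteq> \<Omega>" using control_volume[OF t] body[OF t] by auto
  have U: "U \<in> sets lebesgue" using lagrangian_domain by auto
  note moment = spread_force_rigid_moment[OF delta domain U _ multiplier[OF t] delta_mass[OF t]
      force[OF t] bCV CV(1) force_support[OF t] A(1), of a]
  have cont: "continuous_on U (X t)" using position[OF t] by simp
  \<comment> \<open>The force vanishes in \<open>\<Omega>\<close> outside the control volume, so
    moments over \<open>\<Omega>\<close> are moments over \<open>CV t\<close>.\<close>
  have on_CV: "indicator \<Omega> x *\<^sub>R (\<kappa> x \<bullet> f t x) = indicator (CV t) x *\<^sub>R (\<kappa> x \<bullet> f t x)" for x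
    using force_support[OF t, of x] CV(2) by (auto split: split_indicator)
  show "set_integrable lebesgue U (\<lambda>s. (a + A (X t s)) \<bullet> F t s)"
    by (rule moment(1)[OF cont])
  have fi: "set_integrable lebesgue (CV t) (\<lambda>x. \<kappa> x \<bullet> f t x)"
    using moment(2)[OF cont] unfolding set_integrable_def \<kappa>_def[symmetric] on_CV .
  then show "set_integrable lebesgue (CV t) (\<lambda>x. (a + A x) \<bullet> f t x)" by (simp add: \<kappa>_def)
  have fw: "(LINT x:CV t|lebesgue. \<kappa> x \<bullet> f t x) = (LINT s:U|lebesgue. (a + A (X t s)) \<bullet> F t s)"
    using moment(3)[OF cont] unfolding set_lebesgue_integral_def \<kappa>_def[symmetric] on_CV .
  then show "(LINT x:CV t|lebesgue. (a + A x) \<bullet> f t x) = (LINT s:U|lebesgue. (a + A (X t s)) \<bullet> F t s)"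
    by (simp add: \<kappa>_def)
  have "lipschitz_field (closure (CV t)) \<kappa>"
    unfolding \<kappa>_def[abs_def] using A(1)
    by (intro lipschitz_field_add lipschitz_field_const lipschitz_field_bounded_linear)
      (simp add: linear_conv_bounded_linear)
  then have "lipschitz_field (closure (CV t)) H"
    unfolding H_def[abs_def] using regularity[OF t] bCV
    by (intro lipschitz_field_momentum_flux) auto
  note gaussH = gauss[OF this]
  have flux: "H x \<bullet> n t x = \<kappa> x \<bullet> momentum_flux \<rho> \<mu> (u t) (p t) x (n t x)" if "x \<in> frontier (CV t)" for x
  proof -
    have "u t differentiable (at x)" using regularity[OF t] that by (auto simp: frontier_def)
    from momentum_flux_symmetric[OF this] show ?thesis unfolding H_def by (simp add: inner_commute)
  qed
  show "set_integrable surface_measure (frontier (CV t))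
      (\<lambda>x. (a + A x) \<bullet> momentum_flux \<rho> \<mu> (u t) (p t) x (n t x))"
    unfolding \<kappa>_def[symmetric]
    by (subst set_integrable_cong[OF refl refl flux[symmetric]]) (use gaussH in auto)
  \<comment> \<open>The momentum equation inside the control volume, tested with
    \<open>\<kappa>\<close>. It is written with indicators so that the identity holds almost
    everywhere in the whole space.\<close>
  have div_ae: "AE x in lebesgue. indicator (CV t) x *\<^sub>R divergence H x + indicator (CV t) x *\<^sub>R (\<kappa> x \<bullet> f t x) =
      indicator (CV t) x *\<^sub>R (\<kappa> x \<bullet> (\<rho> *\<^sub>R time_deriv u t x))"
    using momentum[OF t]
  proof eventually_elim
    case (elim x)
    show ?case
    proof (cases "x \<in> CV t")
      case True
      then have x: "x \<in> \<Omega>" using CV by auto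
      have dv: "u t differentiable (at y)" "divergence (u t) y = 0" if "y \<in> \<Omega>" for y
        using continuity[OF t that] by auto
      have q: "p t differentiable (at x)"
        and v2: "\<And>b. b \<in> Basis \<Longrightarrow> (\<lambda>y. frechet_derivative (u t) (at y) b) differentiable (at x)"
        and eq: "\<rho> *\<^sub>R (time_deriv u t x + convection (u t) x) =
          - gradient (p t) x + \<mu> *\<^sub>R laplacian (u t) x + f t x"
        using elim x by blast+
      have "divergence H x = \<kappa> x \<bullet> (- gradient (p t) x - \<rho> *\<^sub>R convection (u t) x + \<mu> *\<^sub>R laplacian (u t) x)"
        unfolding H_def[abs_def] \<kappa>_def
        by (rule divergence_momentum_flux[OF domain x dv q v2 A])
      also have "- gradient (p t) x - \<rho> *\<^sub>R convection (u t) x + \<mu> *\<^sub>R laplacian (u t) x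
          = \<rho> *\<^sub>R time_deriv u t x - f t x"
        using eq by (simp add: algebra_simps)
      finally show ?thesis using True by (simp add: inner_diff_right)
    qed simp
  qed
  let ?L = "\<lambda>x. indicator (CV t) x *\<^sub>R divergence H x + indicator (CV t) x *\<^sub>R (\<kappa> x \<bullet> f t x)"
  have iL: "integrable lebesgue ?L"
    using gaussH fi unfolding set_integrable_def by (intro Bochner_Integration.integrable_add) auto
  \<comment> \<open>The inertia term inherits measurability, and then integrability, from the
    divergence and force terms through the almost everywhere identity.\<close>
  have meas: "(\<lambda>x. indicator (CV t) x *\<^sub>R (\<kappa> x \<bullet> (\<rho> *\<^sub>R time_deriv u t x))) \<in> borel_measurable lebesgue"
    by (rule borel_measurable_AE[OF borel_measurable_integrable[OF iL] div_ae])
  show "set_integrable lebesgue (CV t) (\<lambda>x. (a + A x) \<bullet> (\<rho> *\<^sub>R time_deriv u t x))"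
    unfolding set_integrable_def \<kappa>_def[symmetric] by (rule integrable_cong_AE_imp[OF iL meas div_ae])
  have "(LINT x:CV t|lebesgue. \<kappa> x \<bullet> (\<rho> *\<^sub>R time_deriv u t x)) = integral\<^sup>L lebesgue ?L"
    unfolding set_lebesgue_integral_def
    by (rule integral_cong_AE[OF borel_measurable_integrable[OF iL] meas div_ae, symmetric])
  also have "\<dots> = (LINT x:CV t|lebesgue. divergence H x) + (LINT x:CV t|lebesgue. \<kappa> x \<bullet> f t x)"
    using gaussH fi unfolding set_integrable_def set_lebesgue_integral_def
    by (intro Bochner_Integration.integral_add) auto
  also have "(LINT x:CV t|lebesgue. divergence H x) = (LINT x:frontier (CV t)|surface_measure. H x \<bullet> n t x)"
    using gaussH by simp
  also have "\<dots> = (LINT x:frontier (CV t)|surface_measure. \<kappa> x \<bullet> momentum_flux \<rho> \<mu> (u t) (p t) x (n t x))"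
    unfolding set_lebesgue_integral_def using flux
    by (intro Bochner_Integration.integral_cong) (auto split: split_indicator)
  finally show "(LINT s:U|lebesgue. (a + A (X t s)) \<bullet> F t s) =
      (LINT x:CV t|lebesgue. (a + A x) \<bullet> (\<rho> *\<^sub>R time_deriv u t x)) -
      (LINT x:frontier (CV t)|surface_measure. (a + A x) \<bullet> momentum_flux \<rho> \<mu> (u t) (p t) x (n t x))"
    using fw by (simp add: \<kappa>_def)
qed

text \<open>Translations: \<open>A = 0\<close>, and \<open>a\<close> runs through the basis vectors
  to give the components.\<close>

lemma
  assumes t: "t \<in> J"
  shows spread_force_total: "(LINT x:CV t|lebesgue. f t x) = (LINT s:U|lebesgue. F t s)"
    and multiplier_force_balance: "(LINT s:U|lebesgue. F t s) =
      (LINT x:CV t|lebesgue. \<rho> *\<^sub>R time_deriv u t x) -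
      (LINT x:frontier (CV t)|surface_measure. momentum_flux \<rho> \<mu> (u t) (p t) x (n t x))"
proof -
  have A: "linear (\<lambda>x :: 'a. 0 :: 'a)" "\<And>a b :: 'a. (0 :: 'a) \<bullet> b = - ((0 :: 'a) \<bullet> a)"
    by (auto simp: linear_zero)
  have comp: "(b :: 'a) \<bullet> y = y \<bullet> b" for b y by (rule inner_commute)
  note int = force_work_integrable[OF t A] multiplier_work_integrable[OF t A]
    inertia_work_integrable[OF t A] flux_work_integrable[OF t A]
  have f: "set_integrable lebesgue (CV t) (f t)"
    and iu: "set_integrable lebesgue (CV t) (\<lambda>x. \<rho> *\<^sub>R time_deriv u t x)"
    and fl: "set_integrable surface_measure (frontier (CV t)) (\<lambda>x. momentum_flux \<rho> \<mu> (u t) (p t) x (n t x))"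
    by (rule set_integrable_componentwise; use int in \<open>simp add: comp[of _ "f t _"]
        inner_commute[of "momentum_flux _ _ _ _ _ _"] inner_commute[of "time_deriv _ _ _"]\<close>)+
  note inner = set_integral_inner_left[OF f] set_integral_inner_left[OF iu]
    set_integral_inner_left[OF fl] set_integral_inner_left[OF multiplier[OF t]]
  show "(LINT x:CV t|lebesgue. f t x) = (LINT s:U|lebesgue. F t s)"
  proof (rule euclidean_eqI)
    fix b :: 'a
    show "(LINT x:CV t|lebesgue. f t x) \<bullet> b = (LINT s:U|lebesgue. F t s) \<bullet> b"
      using force_work[OF t A, of b] unfolding add_0_right comp[of b] inner .
  qed
  show "(LINT s:U|lebesgue. F t s) = (LINT x:CV t|lebesgue. \<rho> *\<^sub>R time_deriv u t x) -
      (LINT x:frontier (CV t)|surface_measure. momentum_flux \<rho> \<mu> (u t) (p t) x (n t x))"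
  proof (rule euclidean_eqI)
    fix b :: 'a
    show "(LINT s:U|lebesgue. F t s) \<bullet> b = ((LINT x:CV t|lebesgue. \<rho> *\<^sub>R time_deriv u t x) -
      (LINT x:frontier (CV t)|surface_measure. momentum_flux \<rho> \<mu> (u t) (p t) x (n t x))) \<bullet> b"
      using virtual_work[OF t A, of b] unfolding add_0_right comp[of b] inner inner_diff_left .
  qed
qed

text \<open>Rotations about \<open>x0 t\<close> turn the work identity into components of the torque
  balance. Only bilinearity and skew symmetry of \<open>wedge\<close> enter, which treats both
  dimensions together.\<close>

lemma multiplier_torque_balance:
  assumes t: "t \<in> J" and wedge: "bilinear wedge" "\<And>a b. wedge a b = - wedge b a"
  shows "(LINT s:U|lebesgue. wedge (X t s - x0 t) (F t s)) =
    (LINT x:CV t|lebesgue. \<rho> *\<^sub>R wedge (x - x0 t) (time_deriv u t x)) -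
    (LINT x:frontier (CV t)|surface_measure.
       wedge (x - x0 t) (- (p t x *\<^sub>R n t x) + viscous_traction \<mu> (u t) x (n t x))
       - ((n t x \<bullet> u t x) * \<rho>) *\<^sub>R wedge (x - x0 t) (u t x))"
proof -
  \<comment> \<open>\<open>A w\<close> represents \<open>v \<mapsto> wedge x v \<bullet> w\<close>
    by an inner product; for \<open>cross3\<close> it is the rotation generator
    \<open>cross3 w x\<close>.\<close>
  define A where "A w x = (\<Sum>b\<in>Basis. (wedge x b \<bullet> w) *\<^sub>R b)" for w x
  have linr: "linear (wedge x)" and linl: "linear (\<lambda>x. wedge x y)" for x y
    using wedge(1) by (auto simp: bilinear_def)
  have A_inner: "A w x \<bullet> v = wedge x v \<bullet> w" for w x v
  proof -
    have "wedge x v = wedge x (\<Sum>b\<in>Basis. (v \<bullet> b) *\<^sub>R b)" by (simp add: euclidean_representation)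
    also have "\<dots> = (\<Sum>b\<in>Basis. (v \<bullet> b) *\<^sub>R wedge x b)"
      by (simp add: linear_sum[OF linr] linear_cmul[OF linr])
    finally show ?thesis
      by (simp add: A_def inner_sum_left inner_commute[of v] mult.commute)
  qed
  have A: "linear (A w)" "\<And>a b. A w a \<bullet> b = - (A w b \<bullet> a)" for w
  proof -
    show "linear (A w)"
      unfolding A_def[abs_def]
      by (intro linearI) (simp_all add: linear_add[OF linl] linear_cmul[OF linl] inner_add_left
          scaleR_add_left sum.distrib scaleR_sum_right)
    show "A w a \<bullet> b = - (A w b \<bullet> a)" for a b
      unfolding A_inner by (subst wedge(2)) simp
  qed
  \<comment> \<open>The translation part \<open>- A w (x0 t)\<close> moves the centre of rotation to
    the reference point. Time is frozen here, so a moving reference point causes no extra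
    term.\<close>
  have work: "(- A w (x0 t) + A w x) \<bullet> v = wedge (x - x0 t) v \<bullet> w" for w x v
    by (simp add: inner_diff_left A_inner linear_diff[OF linl])
  note int = multiplier_work_integrable[OF t A] inertia_work_integrable[OF t A] flux_work_integrable[OF t A]
  \<comment> \<open>By bilinearity the separate pressure, viscous and convective torques combine
    into the moment of the whole flux.\<close>
  have torque_flux: "wedge (x - x0 t) (- (p t x *\<^sub>R n t x) + viscous_traction \<mu> (u t) x (n t x))
       - ((n t x \<bullet> u t x) * \<rho>) *\<^sub>R wedge (x - x0 t) (u t x)
     = wedge (x - x0 t) (momentum_flux \<rho> \<mu> (u t) (p t) x (n t x))" for x
    by (simp add: momentum_flux_def linear_add[OF linr] linear_diff[OF linr] linear_neg[OF linr]
        linear_cmul[OF linr] mult.commute)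
  have F: "set_integrable lebesgue U (\<lambda>s. wedge (X t s - x0 t) (F t s))"
    and iu: "set_integrable lebesgue (CV t) (\<lambda>x. wedge (x - x0 t) (\<rho> *\<^sub>R time_deriv u t x))"
    and fl: "set_integrable surface_measure (frontier (CV t))
      (\<lambda>x. wedge (x - x0 t) (momentum_flux \<rho> \<mu> (u t) (p t) x (n t x)))"
    by (rule set_integrable_componentwise, unfold work[symmetric], rule int)+
  note inner = set_integral_inner_left[OF F] set_integral_inner_left[OF iu] set_integral_inner_left[OF fl]
  have "(LINT s:U|lebesgue. wedge (X t s - x0 t) (F t s)) =
    (LINT x:CV t|lebesgue. wedge (x - x0 t) (\<rho> *\<^sub>R time_deriv u t x)) -
    (LINT x:frontier (CV t)|surface_measure. wedge (x - x0 t) (momentum_flux \<rho> \<mu> (u t) (p t) x (n t x)))"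
  proof (rule euclidean_eqI)
    fix w :: 'w
    show "(LINT s:U|lebesgue. wedge (X t s - x0 t) (F t s)) \<bullet> w =
      ((LINT x:CV t|lebesgue. wedge (x - x0 t) (\<rho> *\<^sub>R time_deriv u t x)) -
       (LINT x:frontier (CV t)|surface_measure. wedge (x - x0 t) (momentum_flux \<rho> \<mu> (u t) (p t) x (n t x)))) \<bullet> w"
      using virtual_work[OF t A, of "- A w (x0 t)" w] unfolding work inner inner_diff_left .
  qed
  then show ?thesis unfolding torque_flux unfolding linear_cmul[OF linr] .
qed

text \<open>Inserting the two balances cancels the inertia and surface integrals. What remains is
  equality of the time derivatives of the body momenta, where \<open>x0 \<tau>\<close> varies in the
  same way on both sides.\<close>

lemma control_volume_multiplier_equivalence:
  assumes t: "t \<in> J" and wedge: "bilinear wedge" "\<And>a b. wedge a b = - wedge b a"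
  shows "(LINT x:CV t|lebesgue. f t x) = (LINT s:U|lebesgue. F t s) \<and>
         (LINT s:U|lebesgue. F t s) =
           (LINT x:CV t|lebesgue. \<rho> *\<^sub>R time_deriv u t x)
           - (LINT x:frontier (CV t)|surface_measure. momentum_flux \<rho> \<mu> (u t) (p t) x (n t x)) \<and>
         - (LINT x:CV t|lebesgue. \<rho> *\<^sub>R time_deriv u t x)
           + vector_derivative (\<lambda>\<tau>. LINT x:Vb \<tau>|lebesgue. \<rho> *\<^sub>R u \<tau> x) (at t)
           + (LINT x:frontier (CV t)|surface_measure. momentum_flux \<rho> \<mu> (u t) (p t) x (n t x))
         = vector_derivative (\<lambda>\<tau>. LINT s:U|lebesgue. \<rho> *\<^sub>R V \<tau> s) (at t)
           - (LINT s:U|lebesgue. F t s) \<and>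
         - (LINT x:CV t|lebesgue. \<rho> *\<^sub>R wedge (x - x0 t) (time_deriv u t x))
           + vector_derivative (\<lambda>\<tau>. LINT x:Vb \<tau>|lebesgue. \<rho> *\<^sub>R wedge (x - x0 \<tau>) (u \<tau> x)) (at t)
           + (LINT x:frontier (CV t)|surface_measure.
                wedge (x - x0 t) (- (p t x *\<^sub>R n t x) + viscous_traction \<mu> (u t) x (n t x))
                - ((n t x \<bullet> u t x) * \<rho>) *\<^sub>R wedge (x - x0 t) (u t x))
         = vector_derivative (\<lambda>\<tau>. LINT s:U|lebesgue. \<rho> *\<^sub>R wedge (X \<tau> s - x0 \<tau>) (V \<tau> s)) (at t)
           - (LINT s:U|lebesgue. wedge (X t s - x0 t) (F t s))"
proof (intro conjI)
  show "(LINT x:CV t|lebesgue. f t x) = (LINT s:U|lebesgue. F t s)"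
    by (rule spread_force_total[OF t])
qed (simp_all only: multiplier_force_balance[OF t] multiplier_torque_balance[OF t wedge]
    vector_derivative_cong_open[OF times t linear_momentum]
    vector_derivative_cong_open[OF times t angular_momentum] algebra_simps add_minus_cancel)

end

section \<open>Specialisation to two and three dimensions\<close>

lemma bilinear_wedge2: "bilinear wedge2"
  by (auto simp: bilinear_def wedge2_def algebra_simps intro!: linearI)

lemma wedge2_skew: "wedge2 a b = - wedge2 b a"
  by (simp add: wedge2_def)

theorem mainTheorem3:
  shows
   "(\<forall>(\<Omega> :: (real^2) set) J \<rho> \<mu> u p f \<delta> U F X V Vb CV n x0.
      immersed_body_cv wedge2 \<Omega> J \<rho> \<mu> u p f \<delta> U F X V Vb CV n x0 \<longrightarrow>
      (\<forall>t\<in>J.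
         (LINT x:CV t|lebesgue. f t x) = (LINT s:U|lebesgue. F t s) \<and>
         (LINT s:U|lebesgue. F t s) =
           (LINT x:CV t|lebesgue. \<rho> *\<^sub>R time_deriv u t x)
           - (LINT x:frontier (CV t)|surface_measure. momentum_flux \<rho> \<mu> (u t) (p t) x (n t x)) \<and>
         - (LINT x:CV t|lebesgue. \<rho> *\<^sub>R time_deriv u t x)
           + vector_derivative (\<lambda>\<tau>. LINT x:Vb \<tau>|lebesgue. \<rho> *\<^sub>R u \<tau> x) (at t)
           + (LINT x:frontier (CV t)|surface_measure. momentum_flux \<rho> \<mu> (u t) (p t) x (n t x))
         = vector_derivative (\<lambda>\<tau>. LINT s:U|lebesgue. \<rho> *\<^sub>R V \<tau> s) (at t)
           - (LINT s:U|lebesgue. F t s) \<and>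
         - (LINT x:CV t|lebesgue. \<rho> *\<^sub>R wedge2 (x - x0 t) (time_deriv u t x))
           + vector_derivative (\<lambda>\<tau>. LINT x:Vb \<tau>|lebesgue. \<rho> *\<^sub>R wedge2 (x - x0 \<tau>) (u \<tau> x)) (at t)
           + (LINT x:frontier (CV t)|surface_measure.
                wedge2 (x - x0 t) (- (p t x *\<^sub>R n t x) + viscous_traction \<mu> (u t) x (n t x))
                - ((n t x \<bullet> u t x) * \<rho>) *\<^sub>R wedge2 (x - x0 t) (u t x))
         = vector_derivative (\<lambda>\<tau>. LINT s:U|lebesgue. \<rho> *\<^sub>R wedge2 (X \<tau> s - x0 \<tau>) (V \<tau> s)) (at t)
           - (LINT s:U|lebesgue. wedge2 (X t s - x0 t) (F t s)))) \<and>
    (\<forall>(\<Omega> :: (real^3) set) J \<rho> \<mu> u p f \<delta> U F X V Vb CV n x0.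
      immersed_body_cv cross3 \<Omega> J \<rho> \<mu> u p f \<delta> U F X V Vb CV n x0 \<longrightarrow>
      (\<forall>t\<in>J.
         (LINT x:CV t|lebesgue. f t x) = (LINT s:U|lebesgue. F t s) \<and>
         (LINT s:U|lebesgue. F t s) =
           (LINT x:CV t|lebesgue. \<rho> *\<^sub>R time_deriv u t x)
           - (LINT x:frontier (CV t)|surface_measure. momentum_flux \<rho> \<mu> (u t) (p t) x (n t x)) \<and>
         - (LINT x:CV t|lebesgue. \<rho> *\<^sub>R time_deriv u t x)
           + vector_derivative (\<lambda>\<tau>. LINT x:Vb \<tau>|lebesgue. \<rho> *\<^sub>R u \<tau> x) (at t)
           + (LINT x:frontier (CV t)|surface_measure. momentum_flux \<rho> \<mu> (u t) (p t) x (n t x))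
         = vector_derivative (\<lambda>\<tau>. LINT s:U|lebesgue. \<rho> *\<^sub>R V \<tau> s) (at t)
           - (LINT s:U|lebesgue. F t s) \<and>
         - (LINT x:CV t|lebesgue. \<rho> *\<^sub>R cross3 (x - x0 t) (time_deriv u t x))
           + vector_derivative (\<lambda>\<tau>. LINT x:Vb \<tau>|lebesgue. \<rho> *\<^sub>R cross3 (x - x0 \<tau>) (u \<tau> x)) (at t)
           + (LINT x:frontier (CV t)|surface_measure.
                cross3 (x - x0 t) (- (p t x *\<^sub>R n t x) + viscous_traction \<mu> (u t) x (n t x))
                - ((n t x \<bullet> u t x) * \<rho>) *\<^sub>R cross3 (x - x0 t) (u t x))
         = vector_derivative (\<lambda>\<tau>. LINT s:U|lebesgue. \<rho> *\<^sub>R cross3 (X \<tau> s - x0 \<tau>) (V \<tau> s)) (at t)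
           - (LINT s:U|lebesgue. cross3 (X t s - x0 t) (F t s))))"
  proof (rule conjI; intro allI impI ballI)
qed (rule immersed_body_cv.control_volume_multiplier_equivalence
    [OF _ _ bilinear_wedge2 wedge2_skew], assumption+,
  rule immersed_body_cv.control_volume_multiplier_equivalence
    [OF _ _ bilinear_cross cross_skew], assumption+)

end
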